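(* Let $\mu$ be a Paley measure on $\mathbb{R}$ such that $\mu([-\delta,\delta])=0$ for some $\delta>0$. For every compact set $K\subset\mathbb{R}$ there is a constant $C=C(\mu,K)>0$ such that for every function $f$ with $\mathrm{supp}(f)\subset K$ (and $\int_K|f|\log^{1/2}(1+|f|)\,dx<\infty$) one has $$\|\widehat{f}\|_{L^2(d\mu)}\le C(\mu,K)\Big[\int_K|f(x)|\log^{1/2}(1+|f(x)|)\,dx+1\Big].$$
   Context: Let $\mathcal{I}$ be the class of all intervals of the form $\pm[2^k,2^{k+1})$, $k\in\mathbb{Z}$ (i.e. $[2^k,2^{k+1})$ and its reflection $(-2^{k+1},-2^k]$). A non-negative (Borel) measure $\mu$ on $\mathbb{R}$ is called a Paley measure if $\sup_{I\in\mathcal{I}}\mu(I)<\infty$. $\widehat{f}$ denotes the Fourier transform of $f$ on $\mathbb{R}$, a continuous function since $f$ is integrable. *)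

theory Defs
  imports "HOL-Analysis.Analysis"
begin

definition dyadic_intervals :: "real set set" where
  "dyadic_intervals =
     range (\<lambda>k::int. {2 powi k ..< 2 powi (k + 1)}) \<union>
     range (\<lambda>k::int. {- (2 powi (k + 1)) <.. - (2 powi k)})"

definition paley_measure :: "real measure \<Rightarrow> bool" where
  "paley_measure \<mu> \<longleftrightarrow>
     sets \<mu> = sets borel \<and> (SUP I\<in>dyadic_intervals. emeasure \<mu> I) < \<infinity>"

text \<open>The exponent is normalised as \<open>- 2 \<pi> i x \<xi>\<close>. The Bochner integral makes this the usual
  transform for Lebesgue integrable functions and \<open>0\<close> for all others.\<close>

definition fourier_transform :: "(real \<Rightarrow> complex) \<Rightarrow> real \<Rightarrow> complex" where
  "fourier_transform f \<xi> =
     (LINT x|lebesgue. exp (- (2 * of_real pi * \<i> * of_real x * of_real \<xi>)) * f x)"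

definition square_integrable :: "'a measure \<Rightarrow> ('a \<Rightarrow> complex) \<Rightarrow> bool" where
  "square_integrable M g \<longleftrightarrow>
     g \<in> borel_measurable M \<and> integrable M (\<lambda>x. (cmod (g x))\<^sup>2)"

text \<open>Only meaningful together with \<open>square_integrable M g\<close>, since the Bochner integral of a
  non-integrable function is \<open>0\<close>.\<close>

definition l2_norm :: "'a measure \<Rightarrow> ('a \<Rightarrow> complex) \<Rightarrow> real" where
  "l2_norm M g = sqrt (LINT x|M. (cmod (g x))\<^sup>2)"

end

theory Submission
  imports Defs "HOL-Probability.Sinc_Integral"
begin

text \<open>The proof is by duality. Cut the frequency axis into the dyadic annuli beyond \<open>r \<le> \<delta>\<close> and separate
  those of even and of odd index. For \<open>g\<close> in the unit ball of \<open>L\<^sup>2(\<mu>)\<close>, supported in finitely many annuli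
  of one parity, the function \<open>G(x) = \<integral> exp (- 2 \<pi> \<i> x \<xi>) g(\<xi>) d\<mu>(\<xi>)\<close> is a sum of blocks \<open>h j\<close> whose
  frequencies are lacunary. The Paley condition and the Cauchy-Schwarz inequality bound the blocks by
  numbers \<open>b j\<close> with bounded sum of squares.

  Let \<open>w\<close> be a Fejer weight that is bounded below on \<open>K\<close> and has Fourier transform supported near
  \<open>0\<close>. Because of lacunarity a Riesz product \<open>\<Prod> (1 + c j * h j)\<close> of real blocks has the same
  \<open>w\<close>-integral as \<open>1\<close>; this is where \<open>\<mu>\<close> must have no mass near \<open>0\<close>. Together with
  \<open>exp y \<le> y + exp (y\<^sup>2)\<close> this makes \<open>G\<close> subgaussian with respect to \<open>w\<close>, hence
  \<open>exp (G\<^sup>2 / const)\<close> has bounded integral over \<open>K\<close>. Young's inequality for the pair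
  \<open>s * sqrt (ln (1 + s))\<close>, \<open>exp (t\<^sup>2)\<close> then bounds \<open>\<integral> f G\<close>, and taking for \<open>g\<close> the
  normalised conjugate of the transform of \<open>f\<close> gives the claim on finitely many annuli.\<close>

section \<open>Elementary inequalities\<close>

text \<open>Keeping the linear term outside the exponential of the square lets the right side be
  rescaled to a Riesz factor \<open>1 + c * h\<close>. For \<open>x \<le> 1\<close> the bound passes
  through \<open>1 + x + x\<^sup>2\<close>.\<close>

lemma exp_le_self_plus_exp_square: "exp x \<le> x + exp (x\<^sup>2)" for x :: real
proof -
  have sq: "1 + x\<^sup>2 \<le> exp (x\<^sup>2)"
    by simp
  consider "1 < x" | "0 \<le> x" "x \<le> 1" | "x < 0"
    by linarith
  then show ?thesis
  proof cases
    case 1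
    then have "x \<le> x\<^sup>2"
      by (simp add: power2_eq_square)
    then have "exp x \<le> exp (x\<^sup>2)"
      by simp
    then show ?thesis
      using 1 by linarith
  next
    case 2
    then show ?thesis
      using exp_bound[of x] sq by linarith
  next
    case 3
    \<comment> \<open>The product equals \<open>1 - x ^ 3\<close>, which exceeds 1 for negative
      \<open>x\<close>. Replacing \<open>1 - x\<close> by \<open>exp (- x)\<close> then gives the
      quadratic upper bound for \<open>exp x\<close>.\<close>
    have "1 \<le> (1 + x + x\<^sup>2) * (1 - x)"
    proof -
      have "(1 + x + x\<^sup>2) * (1 - x) = 1 + (- x) ^ 3"
        by (simp add: algebra_simps power2_eq_square power3_eq_cube)
      then show ?thesis
        using 3 zero_le_power[of "- x" 3] by linarith
    qed
    also have "\<dots> \<le> (1 + x + x\<^sup>2) * exp (- x)"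
    proof (rule mult_left_mono)
      show "1 - x \<le> exp (- x)"
        using exp_ge_add_one_self[of "- x"] by simp
      have "0 \<le> (1 + 2 * x)\<^sup>2"
        by simp
      then show "0 \<le> 1 + x + x\<^sup>2"
        by (simp add: power2_eq_square algebra_simps)
    qed
    finally have "exp x \<le> 1 + x + x\<^sup>2"
      by (simp add: exp_minus field_simps)
    then show ?thesis
      using sq by linarith
  qed
qed

text \<open>The threshold \<open>4 * sqrt (ln (1 + s))\<close> is chosen so that beyond it
  \<open>s \<le> exp (t\<^sup>2 / 16)\<close>. As also
  \<open>t \<le> 2 * exp (t\<^sup>2 / 16)\<close>, the product has the exponent
  \<open>t\<^sup>2 / 8\<close> that \<open>nn_integral_exp_square_le\<close> controls.\<close>

lemma mult_le_sqrt_ln_plus_exp_square: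
  fixes s t :: real
  assumes "0 \<le> s" "0 \<le> t"
  shows "s * t \<le> 4 * (s * sqrt (ln (1 + s))) + 2 * exp (t\<^sup>2 / 8)"
proof (cases "t \<le> 4 * sqrt (ln (1 + s))")
  case True
  then have "s * t \<le> s * (4 * sqrt (ln (1 + s)))"
    using assms by (intro mult_left_mono)
  also have "\<dots> = 4 * (s * sqrt (ln (1 + s)))"
    by simp
  finally show ?thesis
    using exp_gt_zero[of "t\<^sup>2 / 8"] by linarith
next
  case False
  have ln: "0 \<le> ln (1 + s)"
    using assms by simp
  have "sqrt (ln (1 + s)) \<le> t / 4"
    using False by simp
  then have "(sqrt (ln (1 + s)))\<^sup>2 \<le> (t / 4)\<^sup>2"
    using ln by (intro power_mono) auto
  then have "ln (1 + s) \<le> t\<^sup>2 / 16"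
    using ln by (simp add: power_divide)
  then have "exp (ln (1 + s)) \<le> exp (t\<^sup>2 / 16)"
    by simp
  then have s: "s \<le> exp (t\<^sup>2 / 16)"
    using assms by simp
  have "0 \<le> (t / 4 - 1)\<^sup>2"
    by simp
  then have "t / 2 \<le> 1 + t\<^sup>2 / 16"
    by (simp add: power2_eq_square algebra_simps)
  also have "\<dots> \<le> exp (t\<^sup>2 / 16)"
    by simp
  finally have t: "t \<le> 2 * exp (t\<^sup>2 / 16)"
    by simp
  have "s * t \<le> exp (t\<^sup>2 / 16) * (2 * exp (t\<^sup>2 / 16))"
    using s t assms by (intro mult_mono) auto
  also have "\<dots> = 2 * exp (t\<^sup>2 / 8)"
    by (simp add: exp_add[symmetric])
  also have "\<dots> \<le> 4 * (s * sqrt (ln (1 + s))) + 2 * exp (t\<^sup>2 / 8)"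
    using assms ln by simp
  finally show ?thesis .
qed

lemma one_minus_cos_le: "1 - cos x \<le> x\<^sup>2 / 2" for x :: real
proof -
  have "1 - cos x = 2 * (sin (x / 2))\<^sup>2"
    using cos_double_sin[of "x / 2"] by simp
  also have "\<dots> \<le> 2 * (x / 2)\<^sup>2"
    using abs_sin_x_le_abs_x[of "x / 2"] by (metis abs_le_square_iff mult_left_mono zero_le_numeral)
  finally show ?thesis
    by (simp add: power2_eq_square)
qed

lemma one_minus_cos_ge:
  fixes x :: real
  assumes "\<bar>x\<bar> \<le> 1"
  shows "x\<^sup>2 / 4 \<le> 1 - cos x"
proof -
  define y where "y = \<bar>x\<bar> / 2"
  have y: "0 \<le> y" "y \<le> 1"
    using assms by (auto simp: y_def)
  have "\<bar>sin y - y\<bar> \<le> y ^ 3 / 6"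
    using Maclaurin_sin_bound[of y 3] y
    by (simp add: eval_nat_numeral sin_coeff_def)
  moreover have "y ^ 3 \<le> y"
    using power_decreasing[of 1 3 y] y by simp
  ultimately have "5 / 6 * y \<le> sin y"
    by linarith
  then have "(5 / 6 * y)\<^sup>2 \<le> (sin y)\<^sup>2"
    using y by (intro power_mono) auto
  moreover have "1 - cos x = 2 * (sin y)\<^sup>2"
    using cos_double_sin[of y] by (simp add: y_def)
  moreover have "x\<^sup>2 / 4 \<le> 2 * (5 / 6 * y)\<^sup>2"
    by (simp add: y_def power_mult_distrib power_divide)
  ultimately show ?thesis
    by linarith
qed

subsection \<open>A nonnegative weight whose Fourier transform has compact support\<close>

text \<open>Up to normalisation the Fejer kernel, since \<open>1 - cos (c * x)\<close> is twice the
  square of \<open>sin (c * x / 2)\<close>. Division by zero gives the value 0 at the origin instead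
  of the limit \<open>c\<^sup>2 / 2\<close>, so pointwise lower bounds exclude that point.\<close>

definition fejer :: "real \<Rightarrow> real \<Rightarrow> real" where
  "fejer c x = (1 - cos (c * x)) / x\<^sup>2"

lemma fejer_nonneg [simp]: "0 \<le> fejer c x"
  by (simp add: fejer_def)

lemma borel_measurable_fejer [measurable]: "fejer c \<in> borel_measurable borel"
  unfolding fejer_def[abs_def] by measurable

lemma fejer_lower_bound:
  assumes "\<bar>c * x\<bar> \<le> 1" "x \<noteq> 0"
  shows "c\<^sup>2 / 4 \<le> fejer c x"
  using one_minus_cos_ge[OF assms(1)] assms(2)
  by (simp add: fejer_def field_simps power_mult_distrib)

text \<open>The bound \<open>c\<^sup>2 / 2\<close> near the origin and the bound 2 for
  \<open>x\<^sup>2 * fejer c x\<close> add up to domination by a multiple of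
  \<open>1 / (1 + x\<^sup>2)\<close>.\<close>

lemma integrable_fejer: "integrable lborel (fejer c)"
proof (rule Bochner_Integration.integrable_bound)
  have "integrable lborel (\<lambda>x::real. inverse (1 + x\<^sup>2))"
    using integrable_inverse_1_plus_square by (simp add: set_integrable_def)
  then show "integrable lborel (\<lambda>x::real. (c\<^sup>2 / 2 + 2) * inverse (1 + x\<^sup>2))"
    by simp
  show "fejer c \<in> borel_measurable lborel"
    by simp
  have "fejer c x \<le> (c\<^sup>2 / 2 + 2) * inverse (1 + x\<^sup>2)" for x
  proof (cases "x = 0")
    case False
    have "fejer c x * x\<^sup>2 = 1 - cos (c * x)"
      using False by (simp add: fejer_def)
    then have "fejer c x * x\<^sup>2 \<le> 2"
      using cos_ge_minus_one[of "c * x"] by linarith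
    moreover have "fejer c x \<le> c\<^sup>2 / 2"
      using one_minus_cos_le[of "c * x"] False
      by (simp add: fejer_def field_simps power_mult_distrib)
    ultimately have "fejer c x * (1 + x\<^sup>2) \<le> c\<^sup>2 / 2 + 2"
      by (simp add: algebra_simps)
    moreover have "0 < 1 + x\<^sup>2"
      by (simp add: add_pos_nonneg)
    ultimately show ?thesis
      by (simp add: field_simps)
  qed (simp add: fejer_def)
  moreover have "0 < 1 + x\<^sup>2" for x :: real
    by (simp add: add_pos_nonneg)
  ultimately show "AE x in lborel. norm (fejer c x) \<le> norm ((c\<^sup>2 / 2 + 2) * inverse (1 + x\<^sup>2))"
    by (simp add: less_imp_le)
qed

lemma integral_fejer: "(LINT x|lborel. fejer c x) = \<bar>c\<bar> * (LINT x|lborel. fejer 1 x)"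
proof (cases "c = 0")
  case False
  have "(LINT x|lborel. fejer 1 x) = \<bar>c\<bar> *\<^sub>R (LINT x|lborel. fejer 1 (0 + c * x))"
    using False by (rule lborel_integral_real_affine)
  also have "(\<lambda>x. fejer 1 (0 + c * x)) = (\<lambda>x. fejer c x / c\<^sup>2)"
    by (simp add: fejer_def fun_eq_iff power_mult_distrib)
  finally have "\<bar>c\<bar> * (LINT x|lborel. fejer 1 x) = (\<bar>c\<bar> * \<bar>c\<bar>) * (LINT x|lborel. fejer c x) / c\<^sup>2"
    by simp
  then show ?thesis
    using False by (simp add: power2_eq_square)
qed (simp add: fejer_def)

text \<open>Since \<open>cos (b x) (1 - cos (c x))\<close> is a combination of the numerators \<open>1 - cos (a x)\<close> with
  \<open>a \<in> {b, b + c, b - c}\<close>, the scaling law above suffices and neither the value of the total mass nor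
  Fourier inversion is needed.\<close>

lemma integral_cos_fejer:
  assumes "\<bar>c\<bar> \<le> \<bar>b\<bar>"
  shows "(LINT x|lborel. cos (b * x) * fejer c x) = 0"
proof -
  have "cos (b * x) * fejer c x = (fejer (b + c) x + fejer (b - c) x) / 2 - fejer b x" for x
    by (cases "x = 0")
       (simp_all add: fejer_def field_simps cos_add cos_diff)
  then have "(LINT x|lborel. cos (b * x) * fejer c x) =
      ((LINT x|lborel. fejer (b + c) x) + (LINT x|lborel. fejer (b - c) x)) / 2
        - (LINT x|lborel. fejer b x)"
    by (simp add: integrable_fejer)
  also have "\<dots> = (\<bar>b + c\<bar> / 2 + \<bar>b - c\<bar> / 2 - \<bar>b\<bar>) * (LINT x|lborel. fejer 1 x)"
    by (subst (1 2 3) integral_fejer) (simp add: algebra_simps)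
  \<comment> \<open>This is the tent function of \<open>b\<close>, equal to
    \<open>\<bar>c\<bar> - \<bar>b\<bar>\<close> for \<open>\<bar>b\<bar> < \<bar>c\<bar>\<close>
    and 0 beyond; here the compact support of the transform appears.\<close>
  also have "\<bar>b + c\<bar> / 2 + \<bar>b - c\<bar> / 2 - \<bar>b\<bar> = 0"
    using assms by (auto simp: abs_if field_simps split: if_splits)
  finally show ?thesis
    by simp
qed

text \<open>The integrand is odd: the reflection of the line turns the integral into its own
  negative.\<close>

lemma integral_sin_fejer: "(LINT x|lborel. sin (b * x) * fejer c x) = 0"
proof -
  have "(LINT x|lborel. sin (b * x) * fejer c x)
      = \<bar>-1\<bar> *\<^sub>R (LINT x|lborel. sin (b * (0 + (-1) * x)) * fejer c (0 + (-1) * x))"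
    by (rule lborel_integral_real_affine) simp
  also have "\<dots> = - (LINT x|lborel. sin (b * x) * fejer c x)"
    by (simp add: fejer_def)
  finally show ?thesis
    by simp
qed

lemma integral_cis_fejer:
  assumes "\<bar>c\<bar> \<le> \<bar>b\<bar>"
  shows "(LINT x|lborel. cis (b * x) * of_real (fejer c x)) = 0"
proof -
  have "integrable lborel (\<lambda>x. of_real (cos (b * x) * fejer c x) :: complex)"
       "integrable lborel (\<lambda>x. \<i> * of_real (sin (b * x) * fejer c x))"
    by (auto intro!: integrable_mult_right integrable_of_real
        Bochner_Integration.integrable_bound[OF integrable_fejer[of c]]
        simp: norm_mult mult_left_le_one_le)
  note * = this
  have "cis (b * x) * of_real (fejer c x) =
      of_real (cos (b * x) * fejer c x) + \<i> * of_real (sin (b * x) * fejer c x)" for x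
    by (simp add: complex_eq_iff)
  then have "(LINT x|lborel. cis (b * x) * of_real (fejer c x)) =
      (LINT x|lborel. of_real (cos (b * x) * fejer c x)) +
      (LINT x|lborel. \<i> * of_real (sin (b * x) * fejer c x))"
    by (simp only: Bochner_Integration.integral_add[OF *])
  then show ?thesis
    by (simp only: integral_mult_right_zero integral_complex_of_real
        integral_cos_fejer[OF assms] integral_sin_fejer)
       simp
qed

subsection \<open>Riesz products of lacunary waves\<close>

definition chi :: "real \<Rightarrow> complex" where
  "chi t = cis (- (2 * pi * t))"

lemma chi_add: "chi (s + t) = chi s * chi t"
  by (simp add: chi_def cis_mult algebra_simps)

lemma cnj_chi: "cnj (chi t) = chi (- t)"
  by (simp add: chi_def cis_cnj)

lemma norm_chi [simp]: "cmod (chi t) = 1"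
  by (simp add: chi_def)

lemma chi_0 [simp]: "chi 0 = 1"
  by (simp add: chi_def)

lemma borel_measurable_chi [measurable]: "chi \<in> borel_measurable borel"
  unfolding chi_def[abs_def] cis_conv_exp by measurable

lemma borel_measurable_cnj [measurable]: "cnj \<in> borel_measurable borel"
  by (intro borel_measurable_continuous_onI continuous_intros)

text \<open>The adjoint of the Fourier transform, regarded as a map into functions on the frequency
  side with measure \<open>N\<close>.\<close>

definition wave :: "real measure \<Rightarrow> (real \<Rightarrow> complex) \<Rightarrow> real \<Rightarrow> complex" where
  "wave N g x = (LINT \<xi>|N. chi (x * \<xi>) * g \<xi>)"

text \<open>The last clause says that the Fourier transform of the measure \<open>Q dP\<close>
  vanishes outside \<open>(-\<rho>, \<rho>)\<close>. Boundedness is included so that the property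
  can be carried through products by induction with every integral convergent.\<close>

definition band_limited :: "real measure \<Rightarrow> real \<Rightarrow> (real \<Rightarrow> real) \<Rightarrow> bool" where
  "band_limited P \<rho> Q \<longleftrightarrow>
     Q \<in> borel_measurable borel \<and> (\<exists>B. \<forall>x. \<bar>Q x\<bar> \<le> B) \<and>
     (\<forall>\<eta>. \<rho> \<le> \<bar>\<eta>\<bar> \<longrightarrow> (LINT x|P. chi (\<eta> * x) * of_real (Q x)) = 0)"

text \<open>\<open>P\<close> lives on the space side and will be the Fejer weight; \<open>N\<close>
  lives on the frequency side and will be \<open>\<mu>\<close> cut to finitely many annuli.
  Finiteness makes bounded measurable functions integrable and Fubini's theorem applicable.\<close>

locale finite_borel_pair = P: finite_measure P + N: finite_measure N for P N :: "real measure" +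
  assumes sets_P [measurable_cong, simp]: "sets P = sets borel"
    and sets_N [measurable_cong, simp]: "sets N = sets borel"
begin

lemma space_P [simp]: "space P = UNIV"
  using sets_eq_imp_space_eq[OF sets_P] by simp

lemma space_N [simp]: "space N = UNIV"
  using sets_eq_imp_space_eq[OF sets_N] by simp

sublocale PN: pair_sigma_finite P N ..

lemma integrable_N:
  fixes f :: "real \<Rightarrow> 'b::{banach, second_countable_topology}"
  assumes "f \<in> borel_measurable borel" "\<And>\<xi>. norm (f \<xi>) \<le> B"
  shows "integrable N f"
  using assms by (intro N.integrable_const_bound[where B = B]) auto

lemma integrable_P:
  fixes f :: "real \<Rightarrow> 'b::{banach, second_countable_topology}"
  assumes "f \<in> borel_measurable borel" "\<And>\<xi>. norm (f \<xi>) \<le> B"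
  shows "integrable P f"
  using assms by (intro P.integrable_const_bound[where B = B]) auto

lemma borel_measurable_wave [measurable]:
  assumes [measurable]: "g \<in> borel_measurable borel"
  shows "wave N g \<in> borel_measurable borel"
  unfolding wave_def[abs_def] by (rule N.borel_measurable_lebesgue_integral) measurable

lemma norm_wave_le: "cmod (wave N g x) \<le> (LINT \<xi>|N. cmod (g \<xi>))"
  unfolding wave_def
  using integral_norm_bound[of N "\<lambda>\<xi>. chi (x * \<xi>) * g \<xi>"] by (simp add: norm_mult)

text \<open>By Fubini, multiplication by a wave averages the transform of \<open>Q dP\<close> over
  its shifts by the frequencies \<open>\<xi>\<close>.\<close>

lemma integral_mult_wave:
  assumes Q [measurable]: "Q \<in> borel_measurable borel" "\<And>x. \<bar>Q x\<bar> \<le> B"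
    and g [measurable]: "g \<in> borel_measurable borel" "\<And>\<xi>. cmod (g \<xi>) \<le> A"
  shows "(LINT x|P. chi (\<eta> * x) * of_real (Q x) * wave N g x)
    = (LINT \<xi>|N. g \<xi> * (LINT x|P. chi ((\<eta> + \<xi>) * x) * of_real (Q x)))"
proof -
  let ?F = "\<lambda>x \<xi>. chi (\<eta> * x) * of_real (Q x) * (chi (x * \<xi>) * g \<xi>)"
  have 0: "0 \<le> A" "0 \<le> B"
    using g(2)[of 0] Q(2)[of 0] norm_ge_zero[of "g 0"] by linarith+
  have int: "integrable (P \<Otimes>\<^sub>M N) (case_prod ?F)"
  proof (rule finite_measure.integrable_const_bound)
    show "finite_measure (P \<Otimes>\<^sub>M N)"
      by (intro finite_measure_pair_measure) unfold_locales
    show "AE z in P \<Otimes>\<^sub>M N. norm (case_prod ?F z) \<le> B * A"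
      using Q(2) g(2) 0 by (intro AE_I2) (auto simp: norm_mult intro!: mult_mono)
  qed measurable
  have "(LINT x|P. chi (\<eta> * x) * of_real (Q x) * wave N g x) = (LINT x|P. LINT \<xi>|N. ?F x \<xi>)"
    by (simp add: wave_def)
  also have "\<dots> = (LINT \<xi>|N. LINT x|P. ?F x \<xi>)"
    using PN.Fubini_integral[OF int] by simp
  also have "\<dots> = (LINT \<xi>|N. LINT x|P. g \<xi> * (chi ((\<eta> + \<xi>) * x) * of_real (Q x)))"
    by (simp add: chi_add algebra_simps)
  finally show ?thesis
    by simp
qed

text \<open>Every shifted frequency \<open>\<eta> + \<xi>\<close> with
  \<open>g \<xi> \<noteq> 0\<close> stays outside the band of \<open>Q\<close>, so each inner
  integral vanishes.\<close>

lemma integral_mult_wave_eq_0: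
  assumes Q: "band_limited P \<rho> Q"
    and g: "g \<in> borel_measurable borel" "\<And>\<xi>. cmod (g \<xi>) \<le> A"
    and "\<And>\<xi>. g \<xi> \<noteq> 0 \<Longrightarrow> \<rho> \<le> \<bar>\<eta> + \<xi>\<bar>"
  shows "(LINT x|P. chi (\<eta> * x) * of_real (Q x) * wave N g x) = 0"
proof -
  obtain B where B: "\<And>x. \<bar>Q x\<bar> \<le> B"
    using Q by (auto simp: band_limited_def)
  have 0: "g \<xi> * (LINT x|P. chi ((\<eta> + \<xi>) * x) * of_real (Q x)) = 0" for \<xi>
    using assms(4)[of \<xi>] Q by (auto simp: band_limited_def)
  have "Q \<in> borel_measurable borel"
    using Q by (simp add: band_limited_def)
  from integral_mult_wave[OF this B g] show ?thesis
    by (simp only: 0) simp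
qed

text \<open>The real part is the mean of the wave and its conjugate. The conjugate shifts
  frequencies by \<open>- \<xi>\<close>, whence the two-sided hypothesis.\<close>

lemma integral_mult_Re_wave_eq_0:
  assumes Q: "band_limited P \<rho> Q"
    and g: "g \<in> borel_measurable borel" "\<And>\<xi>. cmod (g \<xi>) \<le> A"
    and far: "\<And>\<xi>. g \<xi> \<noteq> 0 \<Longrightarrow> \<rho> \<le> \<bar>\<eta> + \<xi>\<bar> \<and> \<rho> \<le> \<bar>\<eta> - \<xi>\<bar>"
  shows "(LINT x|P. chi (\<eta> * x) * of_real (Q x * Re (wave N g x))) = 0"
proof -
  note [measurable] = g(1)
  have [measurable]: "Q \<in> borel_measurable borel"
    using Q by (auto simp: band_limited_def)
  obtain B where B: "\<And>x. \<bar>Q x\<bar> \<le> B"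
    using Q by (auto simp: band_limited_def)
  define I where "I = (LINT \<xi>|N. cmod (g \<xi>))"
  have I: "cmod (wave N g x) \<le> I" for x
    unfolding I_def by (rule norm_wave_le)
  have B0: "0 \<le> B"
    using B[of 0] by linarith
  have int: "integrable P (\<lambda>x. chi (\<theta> * x) * of_real (Q x) * wave N g x)" for \<theta>
    using B0 B I by (intro integrable_P[where B = "B * I"]) (auto simp: norm_mult intro!: mult_mono)
  have int': "integrable P (\<lambda>x. chi (\<eta> * x) * of_real (Q x) * cnj (wave N g x))"
    using B0 B I by (intro integrable_P[where B = "B * I"]) (auto simp: norm_mult intro!: mult_mono)
  have 1: "(LINT x|P. chi (\<eta> * x) * of_real (Q x) * wave N g x) = 0"
    using far by (intro integral_mult_wave_eq_0[OF Q g]) auto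
  \<comment> \<open>As \<open>Q\<close> is real, conjugating the whole integral reduces this to the
    previous case at the frequency \<open>- \<eta>\<close>.\<close>
  have "(LINT x|P. chi (\<eta> * x) * of_real (Q x) * cnj (wave N g x)) =
      (LINT x|P. cnj (chi (- \<eta> * x) * of_real (Q x) * wave N g x))"
    by (simp add: cnj_chi)
  also have "\<dots> = cnj (LINT x|P. chi (- \<eta> * x) * of_real (Q x) * wave N g x)"
    by (rule Bochner_Integration.integral_cnj)
  also have "(LINT x|P. chi (- \<eta> * x) * of_real (Q x) * wave N g x) = 0"
    using far by (intro integral_mult_wave_eq_0[OF Q g]) (auto simp: abs_minus_commute)
  finally have 2: "(LINT x|P. chi (\<eta> * x) * of_real (Q x) * cnj (wave N g x)) = 0"
    by simp
  have Re: "of_real (Re z) = (z + cnj z) / 2" for z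
    by (simp add: complex_add_cnj)
  have "(LINT x|P. chi (\<eta> * x) * of_real (Q x * Re (wave N g x))) =
      (LINT x|P. (chi (\<eta> * x) * of_real (Q x) * wave N g x +
        chi (\<eta> * x) * of_real (Q x) * cnj (wave N g x)) / 2)"
    unfolding of_real_mult Re by (simp add: algebra_simps)
  also have "\<dots> = 0"
    using int[of \<eta>] int' 1 2 by simp
  finally show ?thesis .
qed

text \<open>Multiplication corresponds to convolution of spectra, so band radii add.\<close>

lemma band_limited_mult:
  assumes Q: "band_limited P \<rho> Q"
    and g: "g \<in> borel_measurable borel" "\<And>\<xi>. cmod (g \<xi>) \<le> A"
    and u: "\<And>\<xi>. g \<xi> \<noteq> 0 \<Longrightarrow> \<bar>\<xi>\<bar> \<le> u" "0 \<le> u"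
  shows "band_limited P (\<rho> + u) (\<lambda>x. Q x * (1 + c * Re (wave N g x)))"
proof -
  note [measurable] = g(1)
  have [measurable]: "Q \<in> borel_measurable borel"
    using Q by (auto simp: band_limited_def)
  obtain B where B: "\<And>x. \<bar>Q x\<bar> \<le> B"
    using Q by (auto simp: band_limited_def)
  define I where "I = (LINT \<xi>|N. cmod (g \<xi>))"
  have I: "\<bar>Re (wave N g x)\<bar> \<le> I" for x
    unfolding I_def using norm_wave_le[of g x] abs_Re_le_cmod[of "wave N g x"] by linarith
  have B0: "0 \<le> B"
    using B[of 0] by linarith
  have "\<bar>Q x * (1 + c * Re (wave N g x))\<bar> \<le> B * (1 + \<bar>c\<bar> * I)" for x
  proof -
    have "\<bar>c * Re (wave N g x)\<bar> \<le> \<bar>c\<bar> * I"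
      using I[of x] by (simp add: abs_mult mult_left_mono)
    then have "\<bar>1 + c * Re (wave N g x)\<bar> \<le> 1 + \<bar>c\<bar> * I"
      by linarith
    then show ?thesis
      using B[of x] B0 by (auto simp: abs_mult intro!: mult_mono)
  qed
  moreover have "(LINT x|P. chi (\<eta> * x) * of_real (Q x * (1 + c * Re (wave N g x)))) = 0"
    if \<eta>: "\<rho> + u \<le> \<bar>\<eta>\<bar>" for \<eta>
  proof -
    have int1: "integrable P (\<lambda>x. chi (\<eta> * x) * of_real (Q x))"
      using B by (intro integrable_P[where B = B]) (auto simp: norm_mult)
    have int2: "integrable P (\<lambda>x. chi (\<eta> * x) * of_real (Q x * Re (wave N g x)))"
      using B0 B I by (intro integrable_P[where B = "B * I"]) (auto simp: norm_mult abs_mult intro!: mult_mono)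
    have "\<rho> \<le> \<bar>\<eta>\<bar>"
      using \<eta> u(2) by linarith
    then have 1: "(LINT x|P. chi (\<eta> * x) * of_real (Q x)) = 0"
      using Q by (auto simp: band_limited_def)
    have 2: "(LINT x|P. chi (\<eta> * x) * of_real (Q x * Re (wave N g x))) = 0"
    proof (rule integral_mult_Re_wave_eq_0[OF Q g])
      fix \<xi> assume "g \<xi> \<noteq> 0"
      then have "\<bar>\<xi>\<bar> \<le> u"
        by (rule u)
      then show "\<rho> \<le> \<bar>\<eta> + \<xi>\<bar> \<and> \<rho> \<le> \<bar>\<eta> - \<xi>\<bar>"
        using \<eta> by linarith
    qed
    have "(LINT x|P. chi (\<eta> * x) * of_real (Q x * (1 + c * Re (wave N g x)))) =
        (LINT x|P. chi (\<eta> * x) * of_real (Q x) +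
           of_real c * (chi (\<eta> * x) * of_real (Q x * Re (wave N g x))))"
      by (simp add: algebra_simps)
    also have "\<dots> = (LINT x|P. chi (\<eta> * x) * of_real (Q x)) +
        of_real c * (LINT x|P. chi (\<eta> * x) * of_real (Q x * Re (wave N g x)))"
      using int1 int2 by (subst Bochner_Integration.integral_add) auto
    finally show ?thesis
      by (simp only: 1 2) simp
  qed
  ultimately show ?thesis
    unfolding band_limited_def by (intro conjI exI[of _ "B * (1 + \<bar>c\<bar> * I)"]) auto
qed

text \<open>A wave whose frequencies all lie outside the band of \<open>Q\<close> is orthogonal to
  \<open>Q\<close>; this is the case \<open>\<eta> = 0\<close> of the vanishing lemma.\<close>

lemma integral_band_limited_mult:
  assumes Q: "band_limited P \<rho> Q"
    and g: "g \<in> borel_measurable borel" "\<And>\<xi>. cmod (g \<xi>) \<le> A"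
    and l: "\<And>\<xi>. g \<xi> \<noteq> 0 \<Longrightarrow> \<rho> \<le> \<bar>\<xi>\<bar>"
  shows "(LINT x|P. Q x * (1 + c * Re (wave N g x))) = (LINT x|P. Q x)"
proof -
  note [measurable] = g(1)
  have [measurable]: "Q \<in> borel_measurable borel"
    using Q by (auto simp: band_limited_def)
  obtain B where B: "\<And>x. \<bar>Q x\<bar> \<le> B"
    using Q by (auto simp: band_limited_def)
  define I where "I = (LINT \<xi>|N. cmod (g \<xi>))"
  have I: "\<bar>Re (wave N g x)\<bar> \<le> I" for x
    unfolding I_def using norm_wave_le[of g x] abs_Re_le_cmod[of "wave N g x"] by linarith
  have B0: "0 \<le> B"
    using B[of 0] by linarith
  have int: "integrable P Q"
    using B by (intro integrable_P[where B = B]) auto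
  have int': "integrable P (\<lambda>x. Q x * Re (wave N g x))"
    using B0 B I by (intro integrable_P[where B = "B * I"]) (auto simp: abs_mult intro!: mult_mono)
  have "(LINT x|P. chi (0 * x) * of_real (Q x * Re (wave N g x))) = 0"
    using l by (intro integral_mult_Re_wave_eq_0[OF Q g]) auto
  then have "(LINT x|P. complex_of_real (Q x * Re (wave N g x))) = 0"
    by simp
  then have "(LINT x|P. Q x * Re (wave N g x)) = 0"
    unfolding integral_complex_of_real by (simp only: of_real_eq_0_iff)
  then have "(LINT x|P. Q x + c * (Q x * Re (wave N g x))) = (LINT x|P. Q x)"
    using int int' by simp
  then show ?thesis
    by (simp add: algebra_simps)
qed

end

section \<open>Cauchy-Schwarz on a support and exponential square integrability\<close>

definition annulus :: "real \<Rightarrow> real \<Rightarrow> real set" where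
  "annulus a b = {\<xi>. a \<le> \<bar>\<xi>\<bar> \<and> \<bar>\<xi>\<bar> < b}"

lemma annulus_borel [measurable]: "annulus a b \<in> sets borel"
  unfolding annulus_def by measurable

text \<open>Cauchy-Schwarz for \<open>h\<close> and the indicator of \<open>S\<close>: the square of
  \<open>h - t * indicator S\<close> is expanded at the \<open>t\<close> that minimises the
  quadratic once \<open>measure M S\<close> is replaced by \<open>B\<close>.\<close>

lemma (in finite_measure) power2_integral_le_of_support:
  fixes h :: "'a \<Rightarrow> real"
  assumes h [measurable]: "h \<in> borel_measurable M" and bound: "\<And>x. \<bar>h x\<bar> \<le> A"
    and S [measurable]: "S \<in> sets M" and supp: "\<And>x. h x \<noteq> 0 \<Longrightarrow> x \<in> S"
    and B: "measure M S \<le> B" "0 < B"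
  shows "(LINT x|M. h x)\<^sup>2 \<le> B * (LINT x|M. (h x)\<^sup>2)"
proof -
  define t where "t = (LINT x|M. h x) / B"
  have int: "integrable M h"
    using bound by (intro integrable_const_bound[where B = A]) auto
  have int2: "integrable M (\<lambda>x. (h x)\<^sup>2)"
    using power_mono[OF bound abs_ge_zero, of _ 2]
    by (intro integrable_const_bound[where B = "A\<^sup>2"]) auto
  have int3: "integrable M (indicator S :: 'a \<Rightarrow> real)"
    by (intro integrable_const_bound[where B = 1]) auto
  have "0 \<le> (LINT x|M. (h x - t * indicator S x)\<^sup>2)"
    by simp
  also have "(\<lambda>x. (h x - t * indicator S x)\<^sup>2) = (\<lambda>x. (h x)\<^sup>2 - 2 * t * h x + t\<^sup>2 * indicator S x)"
  proof
    fix x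
    show "(h x - t * indicator S x)\<^sup>2 = (h x)\<^sup>2 - 2 * t * h x + t\<^sup>2 * indicator S x"
      using supp[of x] by (cases "x \<in> S") (auto simp: power2_eq_square algebra_simps)
  qed
  also have "(LINT x|M. (h x)\<^sup>2 - 2 * t * h x + t\<^sup>2 * indicator S x) =
      (LINT x|M. (h x)\<^sup>2) - 2 * t * (LINT x|M. h x) + t\<^sup>2 * measure M S"
    using int int2 int3 sets.sets_into_space[OF S] by (simp add: Int_absorb2)
  also have "\<dots> \<le> (LINT x|M. (h x)\<^sup>2) - 2 * t * (LINT x|M. h x) + t\<^sup>2 * B"
    using B by (simp add: mult_left_mono)
  also have "\<dots> = (LINT x|M. (h x)\<^sup>2) - (LINT x|M. h x)\<^sup>2 / B"
    using B by (simp add: t_def field_simps power2_eq_square)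
  finally show ?thesis
    using B by (simp add: field_simps)
qed

text \<open>The exponential of the square is an average of the exponentials of \<open>\<theta> * X\<close> with Gaussian weights
  in \<open>\<theta>\<close>.\<close>

lemma (in finite_measure) nn_integral_exp_square_le:
  fixes X :: "'a \<Rightarrow> real"
  assumes X [measurable]: "X \<in> borel_measurable M"
    and p: "0 \<le> p"
    and mgf: "\<And>\<theta>. (\<integral>\<^sup>+x. exp (\<theta> * X x) \<partial>M) \<le> ennreal (p * exp (\<theta>\<^sup>2))"
  shows "(\<integral>\<^sup>+x. exp ((X x)\<^sup>2 / 8) \<partial>M) \<le> ennreal (sqrt 2 * p)"
proof -
  interpret MxL: pair_sigma_finite M lborel ..
  define k where "k = 1 / sqrt (pi / 2)"
  have k: "0 \<le> k"
    by (simp add: k_def)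
  have gauss: "(\<integral>\<^sup>+\<theta>. normal_density m s \<theta> \<partial>lborel) = 1" if "0 < s" for m s
    using that by (subst nn_integral_eq_integral) auto
  \<comment> \<open>Completing the square: the Gaussian with mean \<open>y / 4\<close> and standard
    deviation \<open>1 / 2\<close> is exactly what turns \<open>exp (y\<^sup>2 / 8)\<close> into an
    exponential linear in \<open>y\<close>.\<close>
  have expand: "exp (y\<^sup>2 / 8) * normal_density (y / 4) (1 / 2) \<theta> = k * exp (\<theta> * y) * exp (- 2 * \<theta>\<^sup>2)"
    for y \<theta> :: real
  proof -
    have "y\<^sup>2 / 8 - 2 * (\<theta> - y / 4)\<^sup>2 = \<theta> * y - 2 * \<theta>\<^sup>2"
      by (simp add: power2_eq_square field_simps)
    then have "exp (y\<^sup>2 / 8) * exp (- (2 * (\<theta> - y / 4)\<^sup>2)) = exp (\<theta> * y) * exp (- 2 * \<theta>\<^sup>2)"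
      unfolding exp_add[symmetric] by simp
    moreover have "normal_density (y / 4) (1 / 2) \<theta> = k * exp (- (2 * (\<theta> - y / 4)\<^sup>2))"
      by (simp add: normal_density_def k_def power_divide)
    ultimately show ?thesis
      by (simp add: algebra_simps)
  qed
  have "(\<integral>\<^sup>+x. exp ((X x)\<^sup>2 / 8) \<partial>M) =
      (\<integral>\<^sup>+x. \<integral>\<^sup>+\<theta>. ennreal (exp ((X x)\<^sup>2 / 8)) * normal_density (X x / 4) (1 / 2) \<theta> \<partial>lborel \<partial>M)"
    by (simp add: nn_integral_cmult gauss)
  also have "\<dots> = (\<integral>\<^sup>+x. \<integral>\<^sup>+\<theta>. ennreal (k * exp (\<theta> * X x) * exp (- 2 * \<theta>\<^sup>2)) \<partial>lborel \<partial>M)"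
    by (simp only: ennreal_mult'[symmetric] exp_ge_zero expand normal_density_nonneg)
  also have "\<dots> = (\<integral>\<^sup>+\<theta>. \<integral>\<^sup>+x. ennreal (k * exp (\<theta> * X x) * exp (- 2 * \<theta>\<^sup>2)) \<partial>M \<partial>lborel)"
    by (rule MxL.Fubini'[symmetric]) measurable
  \<comment> \<open>The hypothesis costs \<open>exp (\<theta>\<^sup>2)\<close> against the available
    \<open>exp (- 2 * \<theta>\<^sup>2)\<close>. What remains is a Gaussian of variance
    \<open>1 / 2\<close>, and \<open>sqrt 2\<close> is the ratio of the normalising
    constants.\<close>
  also have "\<dots> \<le> (\<integral>\<^sup>+\<theta>. ennreal (sqrt 2 * p) * normal_density 0 (1 / sqrt 2) \<theta> \<partial>lborel)"
  proof (rule nn_integral_mono)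
    fix \<theta> :: real
    have "(\<integral>\<^sup>+x. ennreal (k * exp (\<theta> * X x) * exp (- 2 * \<theta>\<^sup>2)) \<partial>M)
        = (\<integral>\<^sup>+x. ennreal (k * exp (- 2 * \<theta>\<^sup>2)) * ennreal (exp (\<theta> * X x)) \<partial>M)"
      using k by (simp add: ennreal_mult'[symmetric] mult_ac)
    also have "\<dots> = ennreal (k * exp (- 2 * \<theta>\<^sup>2)) * (\<integral>\<^sup>+x. exp (\<theta> * X x) \<partial>M)"
      by (rule nn_integral_cmult) measurable
    also have "\<dots> \<le> ennreal (k * exp (- 2 * \<theta>\<^sup>2)) * ennreal (p * exp (\<theta>\<^sup>2))"
      by (intro mult_left_mono mgf) auto
    also have "\<dots> = ennreal (k * p * (exp (- 2 * \<theta>\<^sup>2) * exp (\<theta>\<^sup>2)))"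
      using k p by (simp add: ennreal_mult'[symmetric] mult_ac)
    also have "exp (- 2 * \<theta>\<^sup>2) * exp (\<theta>\<^sup>2) = exp (- \<theta>\<^sup>2)"
      by (simp add: exp_add[symmetric])
    also have "k * p * exp (- \<theta>\<^sup>2) = sqrt 2 * p * normal_density 0 (1 / sqrt 2) \<theta>"
      by (simp add: normal_density_def k_def power_divide real_sqrt_divide)
    finally show "(\<integral>\<^sup>+x. ennreal (k * exp (\<theta> * X x) * exp (- 2 * \<theta>\<^sup>2)) \<partial>M)
        \<le> ennreal (sqrt 2 * p) * normal_density 0 (1 / sqrt 2) \<theta>"
      using p by (simp add: ennreal_mult'[symmetric])
  qed
  also have "\<dots> = ennreal (sqrt 2 * p)"
    by (simp add: nn_integral_cmult gauss)
  finally show ?thesis .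
qed

section \<open>Subgaussian bounds for lacunary sums\<close>

text \<open>\<open>band_P\<close> makes the constant 1 band limited with radius
  \<open>\<epsilon>\<close>. \<open>gap\<close> puts the frequencies of block \<open>j\<close>
  beyond the band of any Riesz product of the earlier blocks; for \<open>j = 0\<close> it keeps them
  away from the origin.\<close>

locale lacunary_pair = finite_borel_pair +
  fixes \<epsilon> A :: real and l u :: "nat \<Rightarrow> real" and g :: "nat \<Rightarrow> real \<Rightarrow> complex"
  assumes band_P: "\<And>\<eta>. \<epsilon> \<le> \<bar>\<eta>\<bar> \<Longrightarrow> (LINT x|P. chi (\<eta> * x)) = 0"
    and measurable_g [measurable]: "\<And>j. g j \<in> borel_measurable borel"
    and bounded_g: "\<And>j \<xi>. cmod (g j \<xi>) \<le> A"
    and support_g: "\<And>j \<xi>. g j \<xi> \<noteq> 0 \<Longrightarrow> \<xi> \<in> annulus (l j) (u j)"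
    and u_nonneg: "\<And>j. 0 \<le> u j"
    and gap: "\<And>j. \<epsilon> + (\<Sum>i<j. u i) \<le> l j"
begin

lemma band_limited_riesz_product:
  "band_limited P (\<epsilon> + (\<Sum>j<n. u j)) (\<lambda>x. \<Prod>j<n. (1 + c j * Re (wave N (g j) x)))"
proof (induction n)
  case 0
  then show ?case
    using band_P by (auto simp: band_limited_def)
next
  case (Suc n)
  have "band_limited P ((\<epsilon> + (\<Sum>j<n. u j)) + u n)
      (\<lambda>x. (\<Prod>j<n. (1 + c j * Re (wave N (g j) x))) * (1 + c n * Re (wave N (g n) x)))"
    using support_g[of n] u_nonneg
    by (intro band_limited_mult[OF Suc.IH measurable_g bounded_g])
       (auto simp: annulus_def less_imp_le)
  then show ?case
    by (simp add: add.assoc)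
qed

text \<open>Each new factor integrates out, because by \<open>gap\<close> its wave is orthogonal to
  the product of the previous ones.\<close>

lemma integral_riesz_product:
  "(LINT x|P. (\<Prod>j<n. (1 + c j * Re (wave N (g j) x)))) = measure P UNIV"
proof (induction n)
  case (Suc n)
  have "(LINT x|P. (\<Prod>j<n. (1 + c j * Re (wave N (g j) x))) * (1 + c n * Re (wave N (g n) x)))
      = (LINT x|P. (\<Prod>j<n. (1 + c j * Re (wave N (g j) x))))"
    using support_g[of n] gap[of n]
    by (intro integral_band_limited_mult[OF band_limited_riesz_product measurable_g bounded_g])
       (fastforce simp: annulus_def)
  then show ?case
    by (simp add: Suc.IH)
qed simp

text \<open>The exponential of the sum is majorised factor by factor by a multiple of a Riesz
  product, whose integral is known exactly.\<close>

lemma nn_integral_exp_sum_wave_le: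
  assumes b: "\<And>j x. \<bar>Re (wave N (g j) x)\<bar> \<le> b j"
  shows "(\<integral>\<^sup>+x. exp (\<theta> * (\<Sum>j<n. Re (wave N (g j) x))) \<partial>P)
    \<le> ennreal (measure P UNIV * exp (\<theta>\<^sup>2 * (\<Sum>j<n. (b j)\<^sup>2)))"
proof -
  \<comment> \<open>This coefficient lets \<open>exp (\<theta>\<^sup>2 * (b j)\<^sup>2)\<close> be
    factored out of \<open>\<theta> * h + exp (\<theta>\<^sup>2 * (b j)\<^sup>2)\<close>, leaving
    \<open>1 + c j * h\<close>.\<close>
  define c where "c j = \<theta> * exp (- (\<theta>\<^sup>2 * (b j)\<^sup>2))" for j
  let ?h = "\<lambda>j x. Re (wave N (g j) x)"
  let ?R = "\<lambda>x. \<Prod>j<n. (1 + c j * ?h j x)"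
  have factor: "exp (\<theta> * ?h j x) \<le> exp (\<theta>\<^sup>2 * (b j)\<^sup>2) * (1 + c j * ?h j x)" for j x
  proof -
    have "(?h j x)\<^sup>2 \<le> (b j)\<^sup>2"
      using power_mono[OF b[of j x] abs_ge_zero, of 2] by simp
    then have "exp ((\<theta> * ?h j x)\<^sup>2) \<le> exp (\<theta>\<^sup>2 * (b j)\<^sup>2)"
      by (simp add: power_mult_distrib mult_left_mono)
    then have "exp (\<theta> * ?h j x) \<le> \<theta> * ?h j x + exp (\<theta>\<^sup>2 * (b j)\<^sup>2)"
      using exp_le_self_plus_exp_square[of "\<theta> * ?h j x"] by linarith
    also have "\<dots> = exp (\<theta>\<^sup>2 * (b j)\<^sup>2) * (1 + c j * ?h j x)"
      by (simp add: c_def distrib_left exp_minus)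
    finally show ?thesis .
  qed
  have le: "exp (\<theta> * (\<Sum>j<n. ?h j x)) \<le> exp (\<theta>\<^sup>2 * (\<Sum>j<n. (b j)\<^sup>2)) * ?R x" for x
  proof -
    have "exp (\<theta> * (\<Sum>j<n. ?h j x)) = (\<Prod>j<n. exp (\<theta> * ?h j x))"
      by (simp add: sum_distrib_left exp_sum)
    also have "\<dots> \<le> (\<Prod>j<n. exp (\<theta>\<^sup>2 * (b j)\<^sup>2) * (1 + c j * ?h j x))"
      by (intro prod_mono conjI factor) simp
    also have "\<dots> = exp (\<theta>\<^sup>2 * (\<Sum>j<n. (b j)\<^sup>2)) * ?R x"
      by (simp add: sum_distrib_left exp_sum prod.distrib)
    finally show ?thesis .
  qed
  \<comment> \<open>No smallness of the \<open>c j\<close> is required: the majorant is nonnegative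
    because it dominates an exponential.\<close>
  have pos: "0 \<le> exp (\<theta>\<^sup>2 * (\<Sum>j<n. (b j)\<^sup>2)) * ?R x" for x
    by (rule order_trans[OF exp_ge_zero le])
  have "band_limited P (\<epsilon> + (\<Sum>j<n. u j)) ?R"
    by (rule band_limited_riesz_product)
  then obtain B where "?R \<in> borel_measurable borel" "\<And>x. \<bar>?R x\<bar> \<le> B"
    by (auto simp: band_limited_def)
  then have int: "integrable P ?R"
    by (intro integrable_P[where B = B]) auto
  have "(\<integral>\<^sup>+x. exp (\<theta> * (\<Sum>j<n. ?h j x)) \<partial>P)
      \<le> (\<integral>\<^sup>+x. exp (\<theta>\<^sup>2 * (\<Sum>j<n. (b j)\<^sup>2)) * ?R x \<partial>P)"
    using le by (intro nn_integral_mono ennreal_leI)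
  also have "\<dots> = ennreal (LINT x|P. exp (\<theta>\<^sup>2 * (\<Sum>j<n. (b j)\<^sup>2)) * ?R x)"
    using int pos by (intro nn_integral_eq_integral) auto
  also have "(LINT x|P. exp (\<theta>\<^sup>2 * (\<Sum>j<n. (b j)\<^sup>2)) * ?R x)
      = measure P UNIV * exp (\<theta>\<^sup>2 * (\<Sum>j<n. (b j)\<^sup>2))"
    by (simp add: integral_riesz_product)
  finally show ?thesis .
qed

text \<open>With \<open>b j\<close> the \<open>L\<^sup>1\<close> norm of \<open>g j\<close>,
  Cauchy-Schwarz on the annulus bounds the sum of the \<open>(b j)\<^sup>2\<close> by
  \<open>s\<^sup>2\<close>. Division by \<open>s\<close> normalises the sum to the moment bound
  \<open>exp (\<theta>\<^sup>2)\<close>.\<close>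

lemma nn_integral_exp_square_sum_wave_le:
  assumes B: "0 < B" "\<And>j. measure N (annulus (l j) (u j)) \<le> B"
    and s: "0 < s" "B * (\<Sum>j<n. LINT \<xi>|N. (cmod (g j \<xi>))\<^sup>2) \<le> s\<^sup>2"
  shows "(\<integral>\<^sup>+x. exp ((((\<Sum>j<n. Re (wave N (g j) x)) / s)\<^sup>2) / 8) \<partial>P)
    \<le> ennreal (sqrt 2 * measure P UNIV)"
proof (rule P.nn_integral_exp_square_le)
  show "(\<lambda>x. (\<Sum>j<n. Re (wave N (g j) x)) / s) \<in> borel_measurable P"
    by measurable
  define b where "b j = (LINT \<xi>|N. cmod (g j \<xi>))" for j
  have b: "\<bar>Re (wave N (g j) x)\<bar> \<le> b j" for j x
    unfolding b_def using norm_wave_le[of "g j" x] abs_Re_le_cmod[of "wave N (g j) x"] by linarith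
  have "(b j)\<^sup>2 \<le> B * (LINT \<xi>|N. (cmod (g j \<xi>))\<^sup>2)" for j
    unfolding b_def
    using B support_g bounded_g
    by (intro N.power2_integral_le_of_support[where S = "annulus (l j) (u j)" and A = A]) auto
  then have "(\<Sum>j<n. (b j)\<^sup>2) \<le> B * (\<Sum>j<n. LINT \<xi>|N. (cmod (g j \<xi>))\<^sup>2)"
    unfolding sum_distrib_left by (rule sum_mono)
  then have "(\<Sum>j<n. (b j)\<^sup>2) \<le> s\<^sup>2"
    using s by linarith
  then have le: "(\<theta> / s)\<^sup>2 * (\<Sum>j<n. (b j)\<^sup>2) \<le> \<theta>\<^sup>2" for \<theta>
    using s mult_left_mono[of "\<Sum>j<n. (b j)\<^sup>2" "s\<^sup>2" "(\<theta> / s)\<^sup>2"] by (simp add: power_divide)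
  show "(\<integral>\<^sup>+x. exp (\<theta> * ((\<Sum>j<n. Re (wave N (g j) x)) / s)) \<partial>P)
      \<le> ennreal (measure P UNIV * exp (\<theta>\<^sup>2))" for \<theta>
    using nn_integral_exp_sum_wave_le[OF b, of "\<theta> / s" n]
    by (simp, elim order_trans) (use le[of \<theta>] in \<open>auto intro!: ennreal_leI mult_left_mono\<close>)
qed simp

end

subsection \<open>Duality with the Orlicz class\<close>

definition orlicz :: "real \<Rightarrow> real" where
  "orlicz s = s * sqrt (ln (1 + s))"

lemma orlicz_nonneg [simp]: "0 \<le> s \<Longrightarrow> 0 \<le> orlicz s"
  by (simp add: orlicz_def)

lemma borel_measurable_orlicz [measurable]: "orlicz \<in> borel_measurable borel"
  unfolding orlicz_def[abs_def] by measurable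

text \<open>On a set of finite measure this makes the Orlicz condition imply integrability. The
  split is where \<open>ln (1 + s)\<close> reaches 1.\<close>

lemma le_exp_plus_orlicz:
  assumes "0 \<le> s"
  shows "s \<le> exp 1 + orlicz s"
proof (cases "1 \<le> ln (1 + s)")
  case True
  then have "s * 1 \<le> orlicz s"
    unfolding orlicz_def using assms by (intro mult_left_mono) auto
  then show ?thesis
    using exp_ge_zero[of 1] by linarith
next
  case False
  then have "exp (ln (1 + s)) < exp 1"
    by simp
  then have "s \<le> exp 1"
    using assms by simp
  then show ?thesis
    using orlicz_nonneg[OF assms] by linarith
qed

text \<open>\<open>dominated\<close> transfers exponential integrals from the weight
  \<open>P\<close> back to Lebesgue measure on \<open>K\<close>; \<open>B\<close> is the Paley bound
  on the annuli.\<close>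

locale dominated_lacunary_pair = lacunary_pair +
  fixes K :: "real set" and D B :: real
  assumes K [measurable]: "K \<in> sets borel"
    and D: "0 \<le> D"
    and dominated: "\<And>\<phi>. \<phi> \<in> borel_measurable borel \<Longrightarrow>
      (\<integral>\<^sup>+x. \<phi> x * indicator K x \<partial>lborel) \<le> ennreal D * (\<integral>\<^sup>+x. \<phi> x \<partial>P)"
    and B: "0 < B" "\<And>j. measure N (annulus (l j) (u j)) \<le> B"
begin

text \<open>Young's inequality is applied pointwise with \<open>t = \<bar>X\<bar> / s\<close>, where
  \<open>X\<close> is the sum of the real parts, and multiplied by \<open>s\<close>. As
  \<open>f\<close> vanishes off \<open>K\<close>, the exponential term is needed on \<open>K\<close>
  only.\<close>

lemma nn_integral_mult_sum_Re_wave_le: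
  fixes f :: "real \<Rightarrow> real"
  assumes f [measurable]: "f \<in> borel_measurable borel" and pos: "\<And>x. 0 \<le> f x"
    and supp: "\<And>x. x \<notin> K \<Longrightarrow> f x = 0"
    and int: "integrable lborel (\<lambda>x. orlicz (f x))"
    and s: "0 < s" "B * (\<Sum>j<n. LINT \<xi>|N. (cmod (g j \<xi>))\<^sup>2) \<le> s\<^sup>2"
  shows "(\<integral>\<^sup>+x. f x * \<bar>\<Sum>j<n. Re (wave N (g j) x)\<bar> \<partial>lborel)
    \<le> ennreal (s * (4 * (LINT x|lborel. orlicz (f x)) + 2 * D * sqrt 2 * measure P UNIV))"
proof -
  let ?X = "\<lambda>x. \<Sum>j<n. Re (wave N (g j) x)"
  have pointwise: "f x * \<bar>?X x\<bar> \<le> 4 * s * orlicz (f x) + 2 * s * exp ((?X x / s)\<^sup>2 / 8) * indicator K x" for x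
  proof (cases "x \<in> K")
    case True
    have "f x * (\<bar>?X x\<bar> / s) \<le> 4 * orlicz (f x) + 2 * exp ((\<bar>?X x\<bar> / s)\<^sup>2 / 8)"
      unfolding orlicz_def using pos s by (intro mult_le_sqrt_ln_plus_exp_square) auto
    then have "s * (f x * (\<bar>?X x\<bar> / s)) \<le> s * (4 * orlicz (f x) + 2 * exp ((\<bar>?X x\<bar> / s)\<^sup>2 / 8))"
      using s by (intro mult_left_mono) auto
    then show ?thesis
      using s True by (simp add: algebra_simps power_divide)
  qed (use supp s in \<open>simp add: orlicz_def\<close>)
  have "(\<integral>\<^sup>+x. f x * \<bar>?X x\<bar> \<partial>lborel) \<le>
      (\<integral>\<^sup>+x. ennreal (4 * s * orlicz (f x)) +
        ennreal (2 * s * exp ((?X x / s)\<^sup>2 / 8)) * indicator K x \<partial>lborel)"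
  proof (rule nn_integral_mono)
    fix x
    have "ennreal (f x * \<bar>?X x\<bar>) \<le>
        ennreal (4 * s * orlicz (f x) + 2 * s * exp ((?X x / s)\<^sup>2 / 8) * indicator K x)"
      by (intro ennreal_leI pointwise)
    also have "\<dots> = ennreal (4 * s * orlicz (f x)) +
        ennreal (2 * s * exp ((?X x / s)\<^sup>2 / 8)) * indicator K x"
      using s pos by (auto simp: indicator_def)
    finally show "ennreal (f x * \<bar>?X x\<bar>) \<le> ennreal (4 * s * orlicz (f x)) +
        ennreal (2 * s * exp ((?X x / s)\<^sup>2 / 8)) * indicator K x" .
  qed
  also have "\<dots> = (\<integral>\<^sup>+x. ennreal (4 * s * orlicz (f x)) \<partial>lborel) +
      (\<integral>\<^sup>+x. ennreal (2 * s * exp ((?X x / s)\<^sup>2 / 8)) * indicator K x \<partial>lborel)"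
    by (rule nn_integral_add) measurable
  also have "(\<integral>\<^sup>+x. ennreal (4 * s * orlicz (f x)) \<partial>lborel) =
      ennreal (4 * s * (LINT x|lborel. orlicz (f x)))"
    using int s pos by (subst nn_integral_eq_integral) auto
  also have "(\<integral>\<^sup>+x. ennreal (2 * s * exp ((?X x / s)\<^sup>2 / 8)) * indicator K x \<partial>lborel)
      \<le> ennreal D * (\<integral>\<^sup>+x. ennreal (2 * s * exp ((?X x / s)\<^sup>2 / 8)) \<partial>P)"
    by (rule dominated) measurable
  also have "(\<integral>\<^sup>+x. ennreal (2 * s * exp ((?X x / s)\<^sup>2 / 8)) \<partial>P) =
      ennreal (2 * s) * (\<integral>\<^sup>+x. exp ((?X x / s)\<^sup>2 / 8) \<partial>P)"
    using s by (subst nn_integral_cmult[symmetric]) (auto simp: ennreal_mult)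
  also have "(\<integral>\<^sup>+x. exp ((?X x / s)\<^sup>2 / 8) \<partial>P) \<le> ennreal (sqrt 2 * measure P UNIV)"
    by (rule nn_integral_exp_square_sum_wave_le[OF B s])
  also have "ennreal (4 * s * (LINT x|lborel. orlicz (f x))) +
      ennreal D * (ennreal (2 * s) * ennreal (sqrt 2 * measure P UNIV)) =
      ennreal (4 * s * (LINT x|lborel. orlicz (f x)) + D * (2 * s * (sqrt 2 * measure P UNIV)))"
    using s D pos by (simp add: ennreal_mult'[symmetric] ennreal_plus[symmetric] del: ennreal_plus)
  also have "4 * s * (LINT x|lborel. orlicz (f x)) + D * (2 * s * (sqrt 2 * measure P UNIV)) =
      s * (4 * (LINT x|lborel. orlicz (f x)) + 2 * D * sqrt 2 * measure P UNIV)"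
    by (simp add: algebra_simps)
  finally show ?thesis
    by (simp add: add_mono mult_left_mono)
qed

text \<open>Multiplying the amplitudes by \<open>- \<i>\<close> turns imaginary parts into real parts.\<close>

lemma rotated: "dominated_lacunary_pair P N \<epsilon> A l u (\<lambda>j \<xi>. - \<i> * g j \<xi>) K D B"
  using band_P bounded_g support_g u_nonneg gap D dominated B
  by unfold_locales (auto simp: norm_mult)

lemma wave_rotated: "wave N (\<lambda>\<xi>. - \<i> * h \<xi>) x = - \<i> * wave N h x"
  unfolding wave_def by (subst integral_mult_right_zero[symmetric]) (simp add: mult_ac)

text \<open>The modulus is at most the sum of the absolute real and imaginary parts, and the latter
  is a real part for the rotated amplitudes; hence the factor 2.\<close>

lemma nn_integral_mult_sum_wave_le:
  fixes f :: "real \<Rightarrow> real"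
  assumes f [measurable]: "f \<in> borel_measurable borel" and pos: "\<And>x. 0 \<le> f x"
    and supp: "\<And>x. x \<notin> K \<Longrightarrow> f x = 0"
    and int: "integrable lborel (\<lambda>x. orlicz (f x))"
    and s: "0 < s" "B * (\<Sum>j<n. LINT \<xi>|N. (cmod (g j \<xi>))\<^sup>2) \<le> s\<^sup>2"
  shows "(\<integral>\<^sup>+x. f x * cmod (\<Sum>j<n. wave N (g j) x) \<partial>lborel)
    \<le> ennreal (2 * s * (4 * (LINT x|lborel. orlicz (f x)) + 2 * D * sqrt 2 * measure P UNIV))"
    (is "_ \<le> ennreal (2 * s * ?C)")
proof -
  interpret rot: dominated_lacunary_pair P N \<epsilon> A l u "\<lambda>j \<xi>. - \<i> * g j \<xi>" K D B
    by (rule rotated)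
  have C: "0 \<le> s * ?C"
    using s D pos by (intro mult_nonneg_nonneg add_nonneg_nonneg) auto
  let ?W = "\<lambda>x. \<Sum>j<n. wave N (g j) x"
  have "(\<integral>\<^sup>+x. f x * cmod (?W x) \<partial>lborel) \<le>
      (\<integral>\<^sup>+x. ennreal (f x * \<bar>\<Sum>j<n. Re (wave N (g j) x)\<bar>) +
        ennreal (f x * \<bar>\<Sum>j<n. Re (wave N (\<lambda>\<xi>. - \<i> * g j \<xi>) x)\<bar>) \<partial>lborel)"
  proof (rule nn_integral_mono)
    fix x
    have "cmod (?W x) \<le> \<bar>Re (?W x)\<bar> + \<bar>Im (?W x)\<bar>"
      by (rule cmod_le)
    also have "Im (?W x) = (\<Sum>j<n. Re (wave N (\<lambda>\<xi>. - \<i> * g j \<xi>) x))"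
      unfolding wave_rotated by simp
    finally have "f x * cmod (?W x) \<le> f x * \<bar>\<Sum>j<n. Re (wave N (g j) x)\<bar> +
        f x * \<bar>\<Sum>j<n. Re (wave N (\<lambda>\<xi>. - \<i> * g j \<xi>) x)\<bar>"
      using pos[of x] by (simp add: distrib_left[symmetric] mult_left_mono)
    then show "ennreal (f x * cmod (?W x)) \<le>
        ennreal (f x * \<bar>\<Sum>j<n. Re (wave N (g j) x)\<bar>) +
        ennreal (f x * \<bar>\<Sum>j<n. Re (wave N (\<lambda>\<xi>. - \<i> * g j \<xi>) x)\<bar>)"
      using pos[of x] by (simp add: ennreal_plus[symmetric] ennreal_leI del: ennreal_plus)
  qed
  also have "\<dots> = (\<integral>\<^sup>+x. f x * \<bar>\<Sum>j<n. Re (wave N (g j) x)\<bar> \<partial>lborel) +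
      (\<integral>\<^sup>+x. f x * \<bar>\<Sum>j<n. Re (wave N (\<lambda>\<xi>. - \<i> * g j \<xi>) x)\<bar> \<partial>lborel)"
    using rot.measurable_g by (intro nn_integral_add) measurable
  also have "\<dots> \<le> ennreal (s * ?C) + ennreal (s * ?C)"
    using s by (intro add_mono nn_integral_mult_sum_Re_wave_le
        rot.nn_integral_mult_sum_Re_wave_le f pos supp int) (auto simp: norm_mult)
  also have "\<dots> = ennreal (2 * s * ?C)"
    using C by (subst ennreal_plus[symmetric]) (auto simp: algebra_simps)
  finally show ?thesis .
qed

end

section \<open>The Fejer weight as a measure, and the dual estimate\<close>

lemma finite_measure_density_fejer: "finite_measure (density lborel (fejer c))"
proof
  have "emeasure (density lborel (fejer c)) (space (density lborel (fejer c))) =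
      (\<integral>\<^sup>+x. fejer c x \<partial>lborel)"
    by (simp add: emeasure_density)
  also have "\<dots> = ennreal (LINT x|lborel. fejer c x)"
    by (intro nn_integral_eq_integral integrable_fejer) simp
  finally show "emeasure (density lborel (fejer c)) (space (density lborel (fejer c))) \<noteq> \<infinity>"
    by simp
qed

lemma integral_chi_density_fejer:
  assumes "\<bar>c\<bar> \<le> \<bar>\<eta>\<bar>"
  shows "(LINT x|density lborel (fejer c). chi (\<eta> * x)) = 0"
proof -
  \<comment> \<open>In the normalisation of \<open>chi\<close> the spectrum is even narrower than
    \<open>\<bar>c\<bar>\<close>; the factor \<open>2 * pi\<close> is simply discarded.\<close>
  have "1 * \<bar>\<eta>\<bar> \<le> 2 * pi * \<bar>\<eta>\<bar>"
    using pi_gt3 by (intro mult_right_mono) auto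
  then have "\<bar>c\<bar> \<le> \<bar>- (2 * pi * \<eta>)\<bar>"
    using assms by (simp add: abs_mult)
  from integral_cis_fejer[OF this]
  have "(LINT x|lborel. fejer c x *\<^sub>R chi (\<eta> * x)) = 0"
    by (simp add: chi_def scaleR_conv_of_real mult_ac)
  then show ?thesis
    by (subst integral_density) auto
qed

lemma nn_integral_le_density_fejer:
  assumes c: "c \<noteq> 0" and K [measurable]: "K \<in> sets borel" "\<And>x. x \<in> K \<Longrightarrow> \<bar>c * x\<bar> \<le> 1"
    and \<phi> [measurable]: "\<phi> \<in> borel_measurable borel"
  shows "(\<integral>\<^sup>+x. \<phi> x * indicator K x \<partial>lborel)
    \<le> ennreal (4 / c\<^sup>2) * (\<integral>\<^sup>+x. \<phi> x \<partial>density lborel (fejer c))"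
proof -
  have "AE x in lborel. x \<noteq> (0::real)"
    by (rule AE_lborel_singleton)
  then have "AE x in lborel. \<phi> x * indicator K x \<le> ennreal (4 / c\<^sup>2) * (ennreal (fejer c x) * \<phi> x)"
  proof eventually_elim
    case (elim x)
    show ?case
    proof (cases "x \<in> K")
      case True
      then have "1 \<le> 4 / c\<^sup>2 * fejer c x"
        using fejer_lower_bound[of c x] K(2)[of x] elim c by (simp add: field_simps)
      then have "1 \<le> ennreal (4 / c\<^sup>2) * ennreal (fejer c x)"
        using c by (simp flip: ennreal_mult'')
      then have "1 * \<phi> x \<le> (ennreal (4 / c\<^sup>2) * ennreal (fejer c x)) * \<phi> x"
        by (intro mult_right_mono) auto
      then show ?thesis
        using True by (simp add: mult_ac)
    qed simp
  qed
  then have "(\<integral>\<^sup>+x. \<phi> x * indicator K x \<partial>lborel) \<le>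
      (\<integral>\<^sup>+x. ennreal (4 / c\<^sup>2) * (ennreal (fejer c x) * \<phi> x) \<partial>lborel)"
    by (rule nn_integral_mono_AE)
  also have "\<dots> = ennreal (4 / c\<^sup>2) * (\<integral>\<^sup>+x. ennreal (fejer c x) * \<phi> x \<partial>lborel)"
    by (rule nn_integral_cmult) measurable
  also have "(\<integral>\<^sup>+x. ennreal (fejer c x) * \<phi> x \<partial>lborel) = (\<integral>\<^sup>+x. \<phi> x \<partial>density lborel (fejer c))"
    by (rule nn_integral_density[symmetric]) measurable
  finally show ?thesis .
qed

text \<open>Duality: with \<open>g j\<close> the conjugate transform cut to an annulus, the left
  side \<open>J\<close> is the integral of \<open>f\<close> against the sum of the waves. The bound
  for that integral is linear in \<open>sqrt J\<close>, so one \<open>sqrt J\<close>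
  cancels.\<close>

lemma (in finite_borel_pair) sum_integral_transform_le:
  fixes f :: "real \<Rightarrow> complex" and l u :: "nat \<Rightarrow> real" and \<epsilon> D B :: real
  assumes band_P: "\<And>\<eta>. \<epsilon> \<le> \<bar>\<eta>\<bar> \<Longrightarrow> (LINT x|P. chi (\<eta> * x)) = 0"
    and u_nonneg: "\<And>j. 0 \<le> u j" and gap: "\<And>j. \<epsilon> + (\<Sum>i<j. u i) \<le> l j"
    and K: "K \<in> sets borel" and D: "0 \<le> D"
    and dominated: "\<And>\<phi>. \<phi> \<in> borel_measurable borel \<Longrightarrow>
      (\<integral>\<^sup>+x. \<phi> x * indicator K x \<partial>lborel) \<le> ennreal D * (\<integral>\<^sup>+x. \<phi> x \<partial>P)"
    and B: "0 < B" "\<And>j. measure N (annulus (l j) (u j)) \<le> B"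
    and f: "integrable lborel f" "\<And>x. x \<notin> K \<Longrightarrow> f x = 0"
      "integrable lborel (\<lambda>x. orlicz (cmod (f x)))"
  shows "(\<Sum>j<n. LINT \<xi>|N. indicator (annulus (l j) (u j)) \<xi> * (cmod (LINT x|lborel. chi (x * \<xi>) * f x))\<^sup>2)
    \<le> 4 * B * (4 * (LINT x|lborel. orlicz (cmod (f x))) + 2 * D * sqrt 2 * measure P UNIV)\<^sup>2"
    (is "?J \<le> 4 * B * ?M\<^sup>2")
proof -
  define F where "F \<xi> = (LINT x|lborel. chi (x * \<xi>) * f x)" for \<xi>
  define A where "A = (LINT x|lborel. cmod (f x))"
  define g where "g j \<xi> = indicator (annulus (l j) (u j)) \<xi> * cnj (F \<xi>)" for j \<xi>
  define J where "J = ?J"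
  have f_meas [measurable]: "f \<in> borel_measurable borel"
    using borel_measurable_integrable[OF f(1)] by simp
  have F_meas [measurable]: "F \<in> borel_measurable borel"
    unfolding F_def by (rule lborel.borel_measurable_lebesgue_integral) measurable
  have g_meas [measurable]: "g j \<in> borel_measurable borel" for j
    unfolding g_def by measurable
  have F_bound: "cmod (F \<xi>) \<le> A" for \<xi>
    unfolding F_def A_def
    using integral_norm_bound[of lborel "\<lambda>x. chi (x * \<xi>) * f x"] by (simp add: norm_mult)
  have A: "0 \<le> A"
    by (simp add: A_def)
  have g_bound: "cmod (g j \<xi>) \<le> A" for j \<xi>
    using F_bound[of \<xi>] A by (simp add: g_def norm_mult indicator_def)
  interpret dominated_lacunary_pair P N \<epsilon> A l u g K D B
    using band_P u_nonneg gap K D dominated B g_bound g_meas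
    by unfold_locales (auto simp: g_def split: split_indicator_asm)
  interpret LN: pair_sigma_finite lborel N ..
  have J_g: "J = (\<Sum>j<n. LINT \<xi>|N. (cmod (g j \<xi>))\<^sup>2)"
    unfolding J_def
    by (intro sum.cong Bochner_Integration.integral_cong refl)
       (simp add: g_def F_def norm_mult power_mult_distrib indicator_def)
  have J0: "0 \<le> J"
    unfolding J_g by (intro sum_nonneg) simp
  have M0: "0 \<le> ?M"
    using D by (intro add_nonneg_nonneg) auto
  have int_g: "integrable N (g j)" for j
    by (rule integrable_N[OF g_meas g_bound])
  have int_fW: "integrable lborel (\<lambda>x. f x * wave N (g j) x)" for j
  proof (rule Bochner_Integration.integrable_bound)
    show "integrable lborel (\<lambda>x. f x * of_real (LINT \<xi>|N. cmod (g j \<xi>)))"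
      using f(1) by simp
    show "AE x in lborel. norm (f x * wave N (g j) x) \<le> norm (f x * of_real (LINT \<xi>|N. cmod (g j \<xi>)))"
      using norm_wave_le[of "g j"] by (auto simp: norm_mult intro!: AE_I2 mult_left_mono)
  qed measurable
  \<comment> \<open>Since \<open>g j * F\<close> is the squared modulus of \<open>g j\<close>,
    inserting the definition of \<open>F\<close> and exchanging the integrals produces the
    wave.\<close>
  have dual: "of_real (LINT \<xi>|N. (cmod (g j \<xi>))\<^sup>2) = (LINT x|lborel. f x * wave N (g j) x)" for j
  proof -
    have int: "integrable (lborel \<Otimes>\<^sub>M N) (\<lambda>(x, \<xi>). f x * (chi (x * \<xi>) * g j \<xi>))"
    proof (rule LN.Fubini_integrable)
      show "integrable lborel (\<lambda>x. LINT \<xi>|N. norm (case (x, \<xi>) of (x, \<xi>) \<Rightarrow> f x * (chi (x * \<xi>) * g j \<xi>)))"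
        using f(1) by (simp add: norm_mult)
      show "AE x in lborel. integrable N (\<lambda>\<xi>. case (x, \<xi>) of (x, \<xi>) \<Rightarrow> f x * (chi (x * \<xi>) * g j \<xi>))"
      proof (rule AE_I2)
        fix x
        have "integrable N (\<lambda>\<xi>. chi (x * \<xi>) * g j \<xi>)"
          using g_bound by (intro integrable_N[where B = A]) (auto simp: norm_mult)
        then show "integrable N (\<lambda>\<xi>. case (x, \<xi>) of (x, \<xi>) \<Rightarrow> f x * (chi (x * \<xi>) * g j \<xi>))"
          by simp
      qed
    qed measurable
    have "complex_of_real (LINT \<xi>|N. (cmod (g j \<xi>))\<^sup>2) = (LINT \<xi>|N. of_real ((cmod (g j \<xi>))\<^sup>2))"
      by (rule integral_complex_of_real[symmetric])
    also have "\<dots> = (LINT \<xi>|N. g j \<xi> * F \<xi>)"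
    proof (rule Bochner_Integration.integral_cong[OF refl])
      fix \<xi>
      show "of_real ((cmod (g j \<xi>))\<^sup>2) = g j \<xi> * F \<xi>"
        using complex_norm_square[of "F \<xi>"]
        by (cases "\<xi> \<in> annulus (l j) (u j)") (auto simp: g_def mult_ac)
    qed
    also have "\<dots> = (LINT \<xi>|N. LINT x|lborel. f x * (chi (x * \<xi>) * g j \<xi>))"
    proof (rule Bochner_Integration.integral_cong[OF refl])
      fix \<xi>
      have "g j \<xi> * F \<xi> = (LINT x|lborel. g j \<xi> * (chi (x * \<xi>) * f x))"
        unfolding F_def by (rule integral_mult_right_zero[symmetric])
      then show "g j \<xi> * F \<xi> = (LINT x|lborel. f x * (chi (x * \<xi>) * g j \<xi>))"
        by (simp add: mult_ac)
    qed
    also have "\<dots> = (LINT x|lborel. LINT \<xi>|N. f x * (chi (x * \<xi>) * g j \<xi>))"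
      by (rule LN.Fubini_integral[OF int])
    finally show ?thesis
      by (simp add: wave_def)
  qed
  have "complex_of_real J = (LINT x|lborel. f x * (\<Sum>j<n. wave N (g j) x))"
    unfolding J_g of_real_sum dual sum_distrib_left
    by (rule Bochner_Integration.integral_sum[symmetric]) (rule int_fW)
  moreover have "integrable lborel (\<lambda>x. f x * (\<Sum>j<n. wave N (g j) x))"
    unfolding sum_distrib_left using int_fW by (intro Bochner_Integration.integrable_sum)
  ultimately have "ennreal (cmod (of_real J)) \<le> (\<integral>\<^sup>+x. cmod (f x * (\<Sum>j<n. wave N (g j) x)) \<partial>lborel)"
    using integral_norm_bound_ennreal by metis
  then have dual_le: "ennreal J \<le> (\<integral>\<^sup>+x. cmod (f x) * cmod (\<Sum>j<n. wave N (g j) x) \<partial>lborel)"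
    using J0 by (simp add: norm_mult)
  have "J \<le> 4 * B * ?M\<^sup>2"
  proof (cases "J = 0")
    case True
    then show ?thesis
      using B by simp
  next
    case False
    \<comment> \<open>The least scale allowed by the dual estimate; it must be positive, which is
      why \<open>J = 0\<close> is treated apart.\<close>
    define s where "s = sqrt (B * J)"
    have s: "0 < s" "s\<^sup>2 = B * J"
      using False J0 B by (auto simp: s_def)
    have "ennreal J \<le> ennreal (2 * s * ?M)"
      using f(2,3) s J_g
      by (intro order_trans[OF dual_le] nn_integral_mult_sum_wave_le) auto
    then have "J \<le> 2 * s * ?M"
      using s M0 by (subst (asm) ennreal_le_iff) auto
    then have "J\<^sup>2 \<le> (2 * s * ?M)\<^sup>2"
      using J0 by (intro power_mono)
    also have "\<dots> = J * (4 * B * ?M\<^sup>2)"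
      by (simp add: power_mult_distrib s(2))
    finally have "J * J \<le> J * (4 * B * ?M\<^sup>2)"
      by (simp add: power2_eq_square)
    then show ?thesis
      using False J0 by (subst (asm) mult_le_cancel_left_pos) auto
  qed
  then show ?thesis
    unfolding J_def .
qed

subsection \<open>Paley measures\<close>

lemma annulus_eq_intervals: "0 < a \<Longrightarrow> annulus a b = {a..<b} \<union> {- b<..- a}"
  by (auto simp: annulus_def)

text \<open>A dyadic annulus is the union of two intervals of the class, which doubles the supremum;
  the added 1 keeps \<open>B\<close> positive.\<close>

lemma paley_measure_annulus:
  assumes "paley_measure \<mu>"
  obtains B where "0 < B" "\<And>k::int. emeasure \<mu> (annulus (2 powi k) (2 powi (k + 1))) \<le> ennreal B"
proof -
  define S where "S = (SUP I\<in>dyadic_intervals. emeasure \<mu> I)"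
  have S: "S < \<infinity>" and [simp]: "sets \<mu> = sets borel"
    using assms by (auto simp: paley_measure_def S_def)
  have "emeasure \<mu> (annulus (2 powi k) (2 powi (k + 1))) \<le> ennreal (2 * enn2real S + 1)" for k :: int
  proof -
    let ?I = "{2 powi k ..< 2 powi (k + 1)} :: real set"
    let ?J = "{- (2 powi (k + 1)) <.. - (2 powi k)} :: real set"
    have "annulus (2 powi k) (2 powi (k + 1)) = ?I \<union> ?J"
      by (rule annulus_eq_intervals) simp
    then have "emeasure \<mu> (annulus (2 powi k) (2 powi (k + 1))) \<le> emeasure \<mu> ?I + emeasure \<mu> ?J"
      by (simp add: emeasure_subadditive)
    also have "\<dots> \<le> S + S"
      unfolding S_def by (intro add_mono SUP_upper) (auto simp: dyadic_intervals_def)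
    also have "\<dots> = ennreal (2 * enn2real S)"
      using S by (cases S) (auto simp flip: ennreal_plus)
    also have "\<dots> \<le> ennreal (2 * enn2real S + 1)"
      by (intro ennreal_leI) simp
    finally show ?thesis .
  qed
  moreover have "0 < 2 * enn2real S + 1"
    by (simp add: add_nonneg_pos)
  ultimately show ?thesis
    using that by blast
qed

lemma indicator_annulus_eq_sum:
  assumes "0 < r"
  shows "indicator (annulus r (r * 2 ^ k)) \<xi> =
    (\<Sum>j<k. indicator (annulus (r * 2 ^ j) (2 * (r * 2 ^ j))) \<xi> :: real)"
proof (induction k)
  case (Suc k)
  have "1 \<le> (2 ^ k :: real)"
    by simp
  then have "r * 1 \<le> r * 2 ^ k"
    using assms by (intro mult_left_mono) auto
  then have "indicator (annulus r (r * 2 ^ Suc k)) \<xi> =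
      (indicator (annulus r (r * 2 ^ k)) \<xi> + indicator (annulus (r * 2 ^ k) (2 * (r * 2 ^ k))) \<xi> :: real)"
    by (auto simp: annulus_def indicator_def)
  then show ?case
    by (simp add: Suc.IH)
qed (auto simp: annulus_def)

text \<open>Consecutive dyadic annuli are not separated enough for the Riesz product argument, but every other
  one is: for \<open>l j = r * 4 ^ j\<close> and \<open>u j = 2 * l j\<close> one has \<open>(\<Sum>i<j. u i) \<le> 2 / 3 * l j\<close>.\<close>

lemma sum_even_odd: "(\<Sum>j<2 * n. a j) = (\<Sum>j<n. a (2 * j)) + (\<Sum>j<n. a (2 * j + 1))"
  for a :: "nat \<Rightarrow> real"
  by (induction n) auto

lemma sum_sparse_radii:
  "3 * (\<Sum>i<j. 2 * (r * 2 ^ (2 * i + q))) = 2 * (r * 2 ^ (2 * j + q)) - 2 * (r * 2 ^ q)" for r :: real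
  by (induction j) (simp_all add: algebra_simps)

text \<open>The dual estimate is applied to the annuli of even and of odd index separately, each
  contributing \<open>4 * B * M\<^sup>2\<close>.\<close>

lemma nn_integral_transform_annulus_le:
  fixes f :: "real \<Rightarrow> complex" and r c B :: real
  assumes \<mu>: "sets \<mu> = sets borel"
    and B: "0 < B" "\<And>j::nat. emeasure \<mu> (annulus (r * 2 ^ j) (2 * (r * 2 ^ j))) \<le> ennreal B"
    and c: "0 < c" "3 * c \<le> r"
    and K: "K \<in> sets borel" "\<And>x. x \<in> K \<Longrightarrow> \<bar>c * x\<bar> \<le> 1"
    and f: "integrable lborel f" "\<And>x. x \<notin> K \<Longrightarrow> f x = 0"
      "integrable lborel (\<lambda>x. orlicz (cmod (f x)))"
  defines "M \<equiv> 4 * (LINT x|lborel. orlicz (cmod (f x))) +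
      2 * (4 / c\<^sup>2) * sqrt 2 * measure (density lborel (fejer c)) UNIV"
  shows "(\<integral>\<^sup>+\<xi>. ennreal ((cmod (LINT x|lborel. chi (x * \<xi>) * f x))\<^sup>2) *
      indicator (annulus r (r * 2 ^ (2 * n))) \<xi> \<partial>\<mu>) \<le> ennreal (8 * B * M\<^sup>2)"
proof -
  note [measurable_cong, simp] = \<mu>
  define F where "F \<xi> = (LINT x|lborel. chi (x * \<xi>) * f x)" for \<xi>
  define E where "E = annulus r (r * 2 ^ (2 * n))"
  define S where "S j = annulus (r * 2 ^ j) (2 * (r * 2 ^ j))" for j :: nat
  define N where "N = density \<mu> (indicator E)"
  have r: "0 < r"
    using c by linarith
  have E [measurable]: "E \<in> sets borel" and S_meas [measurable]: "\<And>j. S j \<in> sets borel"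
    by (auto simp: E_def S_def)
  have sets_N [simp, measurable_cong]: "sets N = sets borel"
    by (simp add: N_def)
  have ind_E: "indicator E \<xi> = (\<Sum>j<2 * n. indicator (S j) \<xi> :: real)" for \<xi>
    unfolding E_def S_def by (rule indicator_annulus_eq_sum[OF r])
  have "E \<subseteq> (\<Union>j<2 * n. S j)"
  proof
    fix \<xi> assume "\<xi> \<in> E"
    then have "(\<Sum>j<2 * n. indicator (S j) \<xi> :: real) \<noteq> 0"
      using ind_E[of \<xi>] by simp
    then show "\<xi> \<in> (\<Union>j<2 * n. S j)"
      by (auto dest!: sum.not_neutral_contains_not_neutral simp: indicator_def split: if_splits)
  qed
  then have "emeasure \<mu> E \<le> emeasure \<mu> (\<Union>j<2 * n. S j)"
    by (intro emeasure_mono) auto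
  also have "\<dots> \<le> (\<Sum>j<2 * n. emeasure \<mu> (S j))"
    by (intro emeasure_subadditive_finite) auto
  also have "\<dots> \<le> (\<Sum>j<2 * n. ennreal B)"
    unfolding S_def by (intro sum_mono B)
  also have "\<dots> < \<infinity>"
    by (simp add: ennreal_mult_less_top of_nat_less_top)
  finally have E_fin: "emeasure \<mu> E < \<infinity>" .
  have N_E: "emeasure N X = emeasure \<mu> (E \<inter> X)" if "X \<in> sets borel" for X
    unfolding N_def using that by (intro emeasure_restricted) auto
  interpret P: finite_measure "density lborel (fejer c)"
    by (rule finite_measure_density_fejer)
  have "space N = UNIV"
    using sets_eq_imp_space_eq[OF sets_N] by simp
  then interpret N: finite_measure N
    using E_fin N_E[of UNIV] by (intro finite_measureI) simp
  interpret finite_borel_pair "density lborel (fejer c)" N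
    by unfold_locales auto
  have N_S: "measure N (S j) \<le> B" for j
  proof -
    have "emeasure N (S j) \<le> emeasure \<mu> (S j)"
      unfolding N_E[OF S_meas] by (intro emeasure_mono) auto
    also have "\<dots> \<le> ennreal B"
      unfolding S_def by (rule B)
    finally show ?thesis
      using B by (simp add: N.emeasure_eq_measure)
  qed
  have sparse: "(\<Sum>j<n. LINT \<xi>|N. indicator (S (2 * j + q)) \<xi> * (cmod (F \<xi>))\<^sup>2) \<le> 4 * B * M\<^sup>2" for q
    unfolding S_def F_def M_def
  proof (rule sum_integral_transform_le[where \<epsilon> = c and K = K])
    \<comment> \<open>The gap condition: the earlier outer radii sum to less than
      \<open>2 / 3\<close> of the new inner radius, and \<open>3 * c \<le> r\<close> leaves room for
      \<open>c\<close> in the remaining third.\<close>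
    fix j
    have "r * 1 \<le> r * 2 ^ q"
      using r by (intro mult_left_mono) auto
    moreover have "0 < r * 2 ^ (2 * j + q)"
      using r by simp
    ultimately show "c + (\<Sum>i<j. 2 * (r * 2 ^ (2 * i + q))) \<le> r * 2 ^ (2 * j + q)"
      using sum_sparse_radii[where r = r and j = j and q = q] c by linarith
    show "0 \<le> 2 * (r * 2 ^ (2 * j + q))"
      using r by simp
    show "measure N (annulus (r * 2 ^ (2 * j + q)) (2 * (r * 2 ^ (2 * j + q)))) \<le> B"
      using N_S by (simp add: S_def)
  next
    fix \<eta> assume "c \<le> \<bar>\<eta>\<bar>"
    then show "(LINT x|density lborel (fejer c). chi (\<eta> * x)) = 0"
      using c by (intro integral_chi_density_fejer) simp
  next
    fix \<phi> :: "real \<Rightarrow> ennreal" assume "\<phi> \<in> borel_measurable borel"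
    then show "(\<integral>\<^sup>+x. \<phi> x * indicator K x \<partial>lborel)
        \<le> ennreal (4 / c\<^sup>2) * (\<integral>\<^sup>+x. \<phi> x \<partial>density lborel (fejer c))"
      using c K by (intro nn_integral_le_density_fejer) auto
  qed (use K B f in auto)
  define A where "A = (LINT x|lborel. cmod (f x))"
  have [measurable]: "f \<in> borel_measurable borel"
    using borel_measurable_integrable[OF f(1)] by simp
  have F_meas [measurable]: "F \<in> borel_measurable borel"
    unfolding F_def by (rule lborel.borel_measurable_lebesgue_integral) measurable
  have F_bound: "cmod (F \<xi>) \<le> A" for \<xi>
    unfolding F_def A_def
    using integral_norm_bound[of lborel "\<lambda>x. chi (x * \<xi>) * f x"] by (simp add: norm_mult)
  have int: "integrable N (\<lambda>\<xi>. indicator X \<xi> * (cmod (F \<xi>))\<^sup>2)" if [measurable]: "X \<in> sets borel" for X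
    using power_mono[OF F_bound norm_ge_zero, of _ 2]
    by (intro integrable_N[where B = "A\<^sup>2"]) (auto simp: indicator_def)
  \<comment> \<open>The indicator is doubled: one copy becomes the density of \<open>N\<close>, the
    other is split into the dyadic pieces.\<close>
  have "(\<integral>\<^sup>+\<xi>. ennreal ((cmod (F \<xi>))\<^sup>2) * indicator E \<xi> \<partial>\<mu>) =
      (\<integral>\<^sup>+\<xi>. indicator E \<xi> * ennreal (indicator E \<xi> * (cmod (F \<xi>))\<^sup>2) \<partial>\<mu>)"
    by (intro nn_integral_cong) (simp add: indicator_def)
  also have "\<dots> = (\<integral>\<^sup>+\<xi>. ennreal (indicator E \<xi> * (cmod (F \<xi>))\<^sup>2) \<partial>N)"
    unfolding N_def by (rule nn_integral_density[symmetric]) measurable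
  also have "\<dots> = ennreal (LINT \<xi>|N. indicator E \<xi> * (cmod (F \<xi>))\<^sup>2)"
    by (intro nn_integral_eq_integral int E) simp
  also have "(LINT \<xi>|N. indicator E \<xi> * (cmod (F \<xi>))\<^sup>2) =
      (\<Sum>j<2 * n. LINT \<xi>|N. indicator (S j) \<xi> * (cmod (F \<xi>))\<^sup>2)"
    unfolding ind_E sum_distrib_right by (intro Bochner_Integration.integral_sum int S_meas)
  also have "\<dots> \<le> 8 * B * M\<^sup>2"
    unfolding sum_even_odd using sparse[of 0] sparse[of 1] by simp
  finally show ?thesis
    by (simp add: F_def E_def ennreal_leI)
qed

text \<open>The bound on annuli does not depend on the number of annuli, so monotone convergence
  extends it to all frequencies.\<close>

lemma nn_integral_transform_le:
  fixes \<mu> :: "real measure" and \<delta> :: real and K :: "real set"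
  assumes paley: "paley_measure \<mu>"
    and \<delta>: "\<delta> > 0" "emeasure \<mu> {-\<delta>..\<delta>} = 0"
    and K: "compact K"
  obtains C where "0 < C"
    "\<And>f. \<lbrakk>integrable lborel f; \<And>x. x \<notin> K \<Longrightarrow> f x = 0; integrable lborel (\<lambda>x. orlicz (cmod (f x)))\<rbrakk> \<Longrightarrow>
      (\<integral>\<^sup>+\<xi>. ennreal ((cmod (LINT x|lborel. chi (x * \<xi>) * f x))\<^sup>2) \<partial>\<mu>)
        \<le> ennreal ((C * ((LINT x|lborel. orlicz (cmod (f x))) + 1))\<^sup>2)"
proof -
  have \<mu> [measurable_cong, simp]: "sets \<mu> = sets borel"
    using paley by (simp add: paley_measure_def)
  obtain B where B: "0 < B"
    "\<And>k::int. emeasure \<mu> (annulus (2 powi k) (2 powi (k + 1))) \<le> ennreal B"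
    using paley_measure_annulus[OF paley] by blast
  \<comment> \<open>The inner radius is taken as a power of two below \<open>\<delta>\<close>, so
    that the annuli starting from it are dyadic.\<close>
  obtain m where m: "(1 / 2) ^ m < \<delta>"
    using real_arch_pow_inv[OF \<delta>(1), of "1 / 2"] by auto
  define r where "r = ((1 / 2) ^ m :: real)"
  have r: "0 < r" "r < \<delta>"
    using m by (auto simp: r_def)
  have B': "emeasure \<mu> (annulus (r * 2 ^ j) (2 * (r * 2 ^ j))) \<le> ennreal B" for j
  proof -
    have "2 powi (int j - int m) = r * 2 ^ j"
      by (simp add: r_def power_int_diff power_divide)
    moreover have "2 powi (int j - int m + 1) = 2 * (2 powi (int j - int m) :: real)"
      by (simp add: power_int_add)
    ultimately show ?thesis
      using B(2)[of "int j - int m"] by simp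
  qed
  obtain R where R: "0 < R" "\<And>x. x \<in> K \<Longrightarrow> \<bar>x\<bar> \<le> R"
    using compact_imp_bounded[OF K] by (auto simp: bounded_pos)
  \<comment> \<open>\<open>r / 3\<close> secures the frequency gaps, \<open>1 / R\<close> the lower
    bound of the weight on \<open>K\<close>.\<close>
  define c where "c = min (r / 3) (1 / R)"
  have c: "0 < c" "3 * c \<le> r" "c \<le> 1 / R"
    using r R by (auto simp: c_def)
  have cK: "\<bar>c * x\<bar> \<le> 1" if "x \<in> K" for x
  proof -
    have "c * \<bar>x\<bar> \<le> 1 / R * R"
      using c R that by (intro mult_mono) auto
    then show ?thesis
      using c R by (simp add: abs_mult)
  qed
  define k where "k = 2 * (4 / c\<^sup>2) * sqrt 2 * measure (density lborel (fejer c)) UNIV"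
  have k: "0 \<le> k"
    by (simp add: k_def)
  define C where "C = sqrt (8 * B) * (4 + k)"
  have AE: "AE \<xi> in \<mu>. r \<le> \<bar>\<xi>\<bar>"
  proof -
    have "{-\<delta>..\<delta>} \<in> null_sets \<mu>"
      using \<delta> by (simp add: null_sets_def)
    then have "AE \<xi> in \<mu>. \<xi> \<notin> {-\<delta>..\<delta>}"
      by (rule AE_not_in)
    then show ?thesis
      by eventually_elim (use r in auto)
  qed
  show ?thesis
  proof (rule that[of C])
    show "0 < C"
      using B k by (simp add: C_def add_pos_nonneg)
    fix f :: "real \<Rightarrow> complex"
    assume f: "integrable lborel f" "\<And>x. x \<notin> K \<Longrightarrow> f x = 0"
      "integrable lborel (\<lambda>x. orlicz (cmod (f x)))"
    define F where "F \<xi> = (LINT x|lborel. chi (x * \<xi>) * f x)" for \<xi>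
    define \<Phi> where "\<Phi> = (LINT x|lborel. orlicz (cmod (f x)))"
    have \<Phi>: "0 \<le> \<Phi>"
      by (simp add: \<Phi>_def)
    have [measurable]: "f \<in> borel_measurable borel"
      using borel_measurable_integrable[OF f(1)] by simp
    have F_meas [measurable]: "F \<in> borel_measurable borel"
      unfolding F_def by (rule lborel.borel_measurable_lebesgue_integral) measurable
    \<comment> \<open>Inner radius 0 makes the supremum equal to the full integrand everywhere; the
      change from \<open>r\<close> affects a null set only.\<close>
    define h where "h n \<xi> = ennreal ((cmod (F \<xi>))\<^sup>2) * indicator (annulus 0 (r * 2 ^ (2 * n))) \<xi>" for n \<xi>
    have sup: "(SUP n. h n \<xi>) = ennreal ((cmod (F \<xi>))\<^sup>2)" for \<xi>
    proof (rule antisym)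
      show "(SUP n. h n \<xi>) \<le> ennreal ((cmod (F \<xi>))\<^sup>2)"
        by (intro SUP_least) (simp add: h_def indicator_def)
      obtain n where n: "\<bar>\<xi>\<bar> / r < 4 ^ n"
        using real_arch_pow[of 4 "\<bar>\<xi>\<bar> / r"] by auto
      then have "\<xi> \<in> annulus 0 (r * 2 ^ (2 * n))"
        using r power_mult[of "2::real" 2 n] by (simp add: annulus_def field_simps)
      then have "ennreal ((cmod (F \<xi>))\<^sup>2) = h n \<xi>"
        by (simp add: h_def)
      also have "\<dots> \<le> (SUP n. h n \<xi>)"
        by (rule SUP_upper) simp
      finally show "ennreal ((cmod (F \<xi>))\<^sup>2) \<le> (SUP n. h n \<xi>)" .
    qed
    have inc: "incseq h"
    proof (intro incseq_SucI le_funI)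
      fix n \<xi>
      have "r * 2 ^ (2 * n) \<le> r * 2 ^ (2 * Suc n)"
        using r by simp
      then show "h n \<xi> \<le> h (Suc n) \<xi>"
        by (auto simp: h_def annulus_def indicator_def)
    qed
    have le: "(\<integral>\<^sup>+\<xi>. h n \<xi> \<partial>\<mu>) \<le> ennreal ((C * (\<Phi> + 1))\<^sup>2)" for n
    proof -
      have "(\<integral>\<^sup>+\<xi>. h n \<xi> \<partial>\<mu>) =
          (\<integral>\<^sup>+\<xi>. ennreal ((cmod (F \<xi>))\<^sup>2) * indicator (annulus r (r * 2 ^ (2 * n))) \<xi> \<partial>\<mu>)"
        using AE by (intro nn_integral_cong_AE) (auto simp: h_def annulus_def indicator_def)
      also have "\<dots> \<le> ennreal (8 * B * (4 * \<Phi> + k)\<^sup>2)"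
        unfolding F_def \<Phi>_def k_def
        using borel_compact[OF K] cK f
        by (intro nn_integral_transform_annulus_le[OF \<mu> B(1) B' c(1,2), where K = K]) auto
      also have "\<dots> \<le> ennreal ((C * (\<Phi> + 1))\<^sup>2)"
      proof (rule ennreal_leI)
        have "4 * \<Phi> + k \<le> (4 + k) * (\<Phi> + 1)"
          using \<Phi> k by (simp add: algebra_simps)
        then have "(4 * \<Phi> + k)\<^sup>2 \<le> ((4 + k) * (\<Phi> + 1))\<^sup>2"
          using \<Phi> k by (intro power_mono) auto
        then have "8 * B * (4 * \<Phi> + k)\<^sup>2 \<le> 8 * B * ((4 + k) * (\<Phi> + 1))\<^sup>2"
          using B by (intro mult_left_mono) auto
        also have "\<dots> = (C * (\<Phi> + 1))\<^sup>2"
          using B by (simp add: C_def power_mult_distrib)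
        finally show "8 * B * (4 * \<Phi> + k)\<^sup>2 \<le> (C * (\<Phi> + 1))\<^sup>2" .
      qed
      finally show ?thesis .
    qed
    have "(\<integral>\<^sup>+\<xi>. ennreal ((cmod (F \<xi>))\<^sup>2) \<partial>\<mu>) = (SUP n. \<integral>\<^sup>+\<xi>. h n \<xi> \<partial>\<mu>)"
      unfolding sup[symmetric]
      by (rule nn_integral_monotone_convergence_SUP[OF inc]) (unfold h_def, measurable)
    also have "\<dots> \<le> ennreal ((C * (\<Phi> + 1))\<^sup>2)"
      by (rule SUP_least) (rule le)
    finally show "(\<integral>\<^sup>+\<xi>. ennreal ((cmod (LINT x|lborel. chi (x * \<xi>) * f x))\<^sup>2) \<partial>\<mu>)
        \<le> ennreal ((C * ((LINT x|lborel. orlicz (cmod (f x))) + 1))\<^sup>2)"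
      by (simp add: F_def \<Phi>_def)
  qed
qed

section \<open>From Borel to Lebesgue measurable functions\<close>

lemma lebesgue_measurable_complex_ex_borel:
  fixes f :: "real \<Rightarrow> complex"
  assumes [measurable]: "f \<in> borel_measurable lebesgue"
  obtains f' where "f' \<in> borel_measurable borel" "AE x in lborel. f x = f' x"
proof -
  have "(\<lambda>x. Re (f x)) \<in> borel_measurable lebesgue" "(\<lambda>x. Im (f x)) \<in> borel_measurable lebesgue"
    by measurable
  from this[THEN completion_ex_borel_measurable_real]
  obtain a b where ab: "a \<in> borel_measurable lborel" "b \<in> borel_measurable lborel"
    "AE x in lborel. Re (f x) = a x" "AE x in lborel. Im (f x) = b x"
    by blast
  show ?thesis
  proof (rule that)
    show "(\<lambda>x. of_real (a x) + \<i> * of_real (b x)) \<in> borel_measurable borel"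
      using ab(1,2) by simp
    show "AE x in lborel. f x = of_real (a x) + \<i> * of_real (b x)"
      using ab(3,4) by eventually_elim (simp add: complex_eq_iff)
  qed
qed

theorem theorem11:
  fixes \<mu> :: "real measure" and \<delta> :: real and K :: "real set"
  assumes "paley_measure \<mu>"
    and "\<delta> > 0" and "emeasure \<mu> {-\<delta>..\<delta>} = 0"
    and "compact K"
  shows "\<exists>C::real. C > 0 \<and>
    (\<forall>f :: real \<Rightarrow> complex.
       f \<in> borel_measurable lebesgue \<longrightarrow>
       closure {x. f x \<noteq> 0} \<subseteq> K \<longrightarrow>
       set_integrable lebesgue K (\<lambda>x. cmod (f x) * sqrt (ln (1 + cmod (f x)))) \<longrightarrow>
       square_integrable \<mu> (fourier_transform f) \<and>
       l2_norm \<mu> (fourier_transform f)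
         \<le> C * ((LINT x:K|lebesgue. cmod (f x) * sqrt (ln (1 + cmod (f x)))) + 1))"
proof -
  have [measurable_cong, simp]: "sets \<mu> = sets borel"
    using assms by (simp add: paley_measure_def)
  obtain C where C: "0 < C"
    "\<And>f. \<lbrakk>integrable lborel f; \<And>x. x \<notin> K \<Longrightarrow> f x = 0; integrable lborel (\<lambda>x. orlicz (cmod (f x)))\<rbrakk> \<Longrightarrow>
      (\<integral>\<^sup>+\<xi>. ennreal ((cmod (LINT x|lborel. chi (x * \<xi>) * f x))\<^sup>2) \<partial>\<mu>)
        \<le> ennreal ((C * ((LINT x|lborel. orlicz (cmod (f x))) + 1))\<^sup>2)"
    using nn_integral_transform_le[OF assms] by blast
  have K [measurable]: "K \<in> sets borel"
    using assms(4) by (rule borel_compact)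
  show ?thesis
  proof (intro exI[of _ C] conjI allI impI C(1))
    fix f :: "real \<Rightarrow> complex"
    assume f [measurable]: "f \<in> borel_measurable lebesgue"
      and supp: "closure {x. f x \<noteq> 0} \<subseteq> K"
      and int: "set_integrable lebesgue K (\<lambda>x. cmod (f x) * sqrt (ln (1 + cmod (f x))))"
    have f_0: "f x = 0" if "x \<notin> K" for x
      using that supp closure_subset[of "{x. f x \<noteq> 0}"] by blast
    obtain f' where f' [measurable]: "f' \<in> borel_measurable borel" "AE x in lborel. f x = f' x"
      using lebesgue_measurable_complex_ex_borel[OF f] by blast
    \<comment> \<open>Cutting the Borel representative to \<open>K\<close> makes it vanish off
      \<open>K\<close> everywhere, not just almost everywhere.\<close>
    define h where "h x = indicator K x * f' x" for x
    have h [measurable]: "h \<in> borel_measurable borel"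
      unfolding h_def by measurable
    have h_0: "h x = 0" if "x \<notin> K" for x
      using that by (simp add: h_def)
    have "AE x in lborel. f x = h x"
      using f'(2) by eventually_elim (auto simp: h_def indicator_def f_0)
    then have AE: "AE x in lebesgue. f x = h x"
      by (rule AE_completion)
    have lebesgue_h: "g \<in> borel_measurable lebesgue" if "g \<in> borel_measurable borel"
      for g :: "real \<Rightarrow> 'a::topological_space"
      using that by (intro measurable_completion) simp
    have orlicz_eq: "AE x in lebesgue. indicator K x *\<^sub>R (cmod (f x) * sqrt (ln (1 + cmod (f x)))) = orlicz (cmod (h x))"
      using AE by eventually_elim (auto simp: orlicz_def indicator_def h_0)
    have meas: "(\<lambda>x. indicator K x *\<^sub>R (cmod (f x) * sqrt (ln (1 + cmod (f x))))) \<in> borel_measurable lebesgue"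
      using int unfolding set_integrable_def by (rule borel_measurable_integrable)
    have meas': "(\<lambda>x. orlicz (cmod (h x))) \<in> borel_measurable lebesgue"
      by (rule lebesgue_h) measurable
    have int_orlicz: "integrable lborel (\<lambda>x. orlicz (cmod (h x)))"
      using int integrable_cong_AE[OF meas meas' orlicz_eq]
      by (simp add: set_integrable_def integrable_completion)
    have orlicz: "(LINT x:K|lebesgue. cmod (f x) * sqrt (ln (1 + cmod (f x)))) = (LINT x|lborel. orlicz (cmod (h x)))"
      unfolding set_lebesgue_integral_def integral_cong_AE[OF meas meas' orlicz_eq]
      by (rule integral_completion) measurable
    \<comment> \<open>Integrability comes from the Orlicz condition and the finite measure of
      \<open>K\<close>.\<close>
    have int_h: "integrable lborel h"
    proof (rule Bochner_Integration.integrable_bound)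
      have "emeasure lborel K < \<infinity>"
        using assms(4) by (rule emeasure_compact_finite)
      then show "integrable lborel (\<lambda>x. exp 1 * indicator K x + orlicz (cmod (h x)))"
        using int_orlicz by simp
      show "AE x in lborel. norm (h x) \<le> norm (exp 1 * indicator K x + orlicz (cmod (h x)))"
        using le_exp_plus_orlicz[of "cmod (h _)"] h_0 by (intro AE_I2) (auto simp: indicator_def)
    qed simp
    have fourier: "fourier_transform f \<xi> = (LINT x|lborel. chi (x * \<xi>) * h x)" for \<xi>
    proof -
      have chi: "exp (- (2 * of_real pi * \<i> * of_real x * of_real \<xi>)) = chi (x * \<xi>)" for x :: real
        by (simp add: chi_def cis_conv_exp mult_ac)
      have "fourier_transform f \<xi> = (LINT x|lebesgue. chi (x * \<xi>) * h x)"
        unfolding fourier_transform_def chi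
      proof (rule integral_cong_AE)
        have [measurable]: "(\<lambda>x. chi (x * \<xi>)) \<in> borel_measurable lebesgue"
          by (rule lebesgue_h) measurable
        show "(\<lambda>x. chi (x * \<xi>) * f x) \<in> borel_measurable lebesgue"
          by measurable
        show "(\<lambda>x. chi (x * \<xi>) * h x) \<in> borel_measurable lebesgue"
          by (rule lebesgue_h) measurable
        show "AE x in lebesgue. chi (x * \<xi>) * f x = chi (x * \<xi>) * h x"
          using AE by eventually_elim simp
      qed
      also have "\<dots> = (LINT x|lborel. chi (x * \<xi>) * h x)"
        by (rule integral_completion) measurable
      finally show ?thesis .
    qed
    have F_meas [measurable]: "fourier_transform f \<in> borel_measurable borel"
      unfolding fourier[abs_def] by (rule lborel.borel_measurable_lebesgue_integral) measurable
    define T where "T = C * ((LINT x|lborel. orlicz (cmod (h x))) + 1)"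
    have T: "0 \<le> T"
      using C(1) by (auto simp: T_def intro!: mult_nonneg_nonneg add_nonneg_nonneg)
    have le: "(\<integral>\<^sup>+\<xi>. ennreal ((cmod (fourier_transform f \<xi>))\<^sup>2) \<partial>\<mu>) \<le> ennreal (T\<^sup>2)"
      unfolding fourier T_def by (rule C(2)[OF int_h h_0 int_orlicz])
    \<comment> \<open>The bound on the nonnegative integral is established first, so that the norm
      below is a genuine integral and not the default value 0.\<close>
    have int_F: "integrable \<mu> (\<lambda>\<xi>. (cmod (fourier_transform f \<xi>))\<^sup>2)"
    proof (rule integrableI_bounded)
      show "(\<integral>\<^sup>+\<xi>. ennreal (norm ((cmod (fourier_transform f \<xi>))\<^sup>2)) \<partial>\<mu>) < \<infinity>"
        using le by (simp add: order_le_less_trans)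
    qed measurable
    then show "square_integrable \<mu> (fourier_transform f)"
      by (simp add: square_integrable_def)
    have "ennreal (LINT \<xi>|\<mu>. (cmod (fourier_transform f \<xi>))\<^sup>2) \<le> ennreal (T\<^sup>2)"
      using le nn_integral_eq_integral[OF int_F] by simp
    then have "(LINT \<xi>|\<mu>. (cmod (fourier_transform f \<xi>))\<^sup>2) \<le> T\<^sup>2"
      by simp
    then have "l2_norm \<mu> (fourier_transform f) \<le> T"
      unfolding l2_norm_def using T by (intro real_le_lsqrt) auto
    then show "l2_norm \<mu> (fourier_transform f)
        \<le> C * ((LINT x:K|lebesgue. cmod (f x) * sqrt (ln (1 + cmod (f x)))) + 1)"
      by (simp add: T_def orlicz)
  qed
qed

end
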